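(* Let $(\mathbf X,\mathbf A,\{\mathbf A(x)\},Q,c)$ be a Markov control process. Let $W:\mathbf X\to[0,\infty)$ be measurable, and let $K>0$, $\gamma\in(0,1)$, $\alpha\in(0,1)$, $\alpha_0\in(0,\alpha)$, $\beta:=\alpha_0/K$ and $w:=1+\beta W$. Let $\mathcal R$ be a risk map on the Markov control process (acting on $\mathscr B_w$) and $\nu$ a real-valued risk measure on $\mathscr B_w$. Assume: (1) $\overline{\mathcal R^\sharp}_{x,a}(W)\le\gamma W(x)+K$ for all $(x,a)\in\mathbf K$; (2) for some $R>2K/(1-\gamma)$, with $B=\{x\in\mathbf X:W(x)\le R\}$, for all $v\ge u$ in $\mathscr B_w$, $$\inf_{x\in B,\,(x,a)\in\mathbf K}\{\mathcal R_{x,a}(v)-\alpha\nu(v)-\mathcal R_{x,a}(u)+\alpha\nu(u)\}\ge0;$$ (3) there is a constant $\overline c\ge0$ with $\sup_{a\in\mathbf A(x)}|c(x,a)|\le\overline c\,w(x)$ for all $x\in\mathbf X$; (4) for each $x\in\mathbf X$: $a\mapsto c(x,a)$ is lower semicontinuous on $\mathbf A(x)$; $\mathbf A(x)$ is compact; and $a\mapsto\mathcal R_{x,a}(u)$ is continuous on $\mathbf A(x)$ for every $u\in\mathscr B_w$. Then there exist a unique $\rho^*\in\mathbb R$ and a function $h\in\mathscr B_w$ satisfying the average risk optimality equation $$\rho^*+h(x)=\inf_{a\in\mathbf A(x)}\{c(x,a)+\mathcal R_{x,a}(h)\}\quad\text{for all }x\in\mathbf X.$$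
   Context: Markov control process: $\mathbf X,\mathbf A$ are Borel spaces (Borel subsets of complete separable metric spaces); for each $x\in\mathbf X$, $\mathbf A(x)\subset\mathbf A$ is a nonempty Borel set of feasible actions; $\mathbf K=\{(x,a):x\in\mathbf X,a\in\mathbf A(x)\}$ is a Borel subset of $\mathbf X\times\mathbf A$; $Q$ is a stochastic kernel on $\mathbf X$ given $\mathbf K$; $c:\mathbf K\to\mathbb R$ is measurable. For measurable $w:\mathbf X\to[1,\infty)$, $\mathscr B_w$ is the space of measurable $u:\mathbf X\to\mathbb R$ with $\|u\|_w=\sup_x|u(x)|/w(x)<\infty$. A real-valued risk measure on $\mathscr B_w$ is a map $\nu:\mathscr B_w\to\mathbb R$ with: $\nu(v)\le\nu(u)$ if $v\le u$ pointwise; $\nu(v+r)=\nu(v)+r$ for constants $r\in\mathbb R$; $\nu(0)=0$. A risk map on the Markov control process is a function $\mathcal R_{x,a}(v)=\mathcal R(v|x,a)$, $v\in\mathscr B_w$, $(x,a)\in\mathbf K$, such that $\mathcal R_{x,a}$ is a real-valued risk measure on $\mathscr B_w$ for each $(x,a)\in\mathbf K$ and $(x,a)\mapsto\mathcal R_{x,a}(v)$ is a real-valued measurable function on $\mathbf K$ for each $v\in\mathscr B_w$. Put $\mathcal R^\sharp_{x,a}(v)=\sup_{u\in\mathscr B_w}\{\mathcal R_{x,a}(v+u)-\mathcal R_{x,a}(u)\}\in\mathbb R\cup\{\infty\}$ and $\overline{\mathcal R^\sharp}_{x,a}(v)=\sup_{\lambda\in\mathbb R,\lambda\neq0}\mathcal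 R^\sharp_{x,a}(\lambda v)/\lambda$. Uniqueness refers to $\rho^*$: it is the only real number for which some $h\in\mathscr B_w$ satisfies the equation. *)

theory Defs
  imports "HOL-Probability.Probability"
begin

text \<open>
  Borel spaces are Borel subsets \<open>X\<close>, \<open>A\<close> of ambient Polish types, with the trace
  Borel \<open>\<sigma>\<close>-algebra. The set of feasible state-action pairs is \<open>Sigma X F\<close>, where
  \<open>F x\<close> is the set of feasible actions in state \<open>x\<close>.
\<close>

locale markov_control_process =
  fixes X :: "'x :: polish_space set"
    and A :: "'a :: polish_space set"
    and F :: "'x \<Rightarrow> 'a set"
    and Q :: "'x \<times> 'a \<Rightarrow> 'x measure"
    and c :: "'x \<times> 'a \<Rightarrow> real"
  assumes borel_states: "X \<in> sets borel"
    and borel_actions: "A \<in> sets borel"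
    and feasible_subset: "\<And>x. x \<in> X \<Longrightarrow> F x \<subseteq> A"
    and feasible_nonempty: "\<And>x. x \<in> X \<Longrightarrow> F x \<noteq> {}"
    and feasible_borel: "\<And>x. x \<in> X \<Longrightarrow> F x \<in> sets borel"
    and feasible_pairs_borel: "Sigma X F \<in> sets borel"
    and kernel: "Q \<in> restrict_space borel (Sigma X F) \<rightarrow>\<^sub>M prob_algebra (restrict_space borel X)"
    and cost_measurable: "c \<in> borel_measurable (restrict_space borel (Sigma X F))"

text \<open>
  Elements of the weighted space on \<open>X\<close> are represented by functions on the whole type, whose
  values outside \<open>X\<close> are irrelevant. A real-valued risk measure cannot see those values
  either: monotonicity is required for the pointwise order on \<open>X\<close>, so two functions that
  agree on \<open>X\<close> have the same risk.
\<close>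

definition wnorm :: "'x set \<Rightarrow> ('x \<Rightarrow> real) \<Rightarrow> ('x \<Rightarrow> real) \<Rightarrow> ereal" where
  "wnorm X w u = (SUP x\<in>X. ereal (\<bar>u x\<bar> / w x))"

definition wspace :: "'x :: topological_space set \<Rightarrow> ('x \<Rightarrow> real) \<Rightarrow> ('x \<Rightarrow> real) set" where
  "wspace X w = {u \<in> borel_measurable (restrict_space borel X). wnorm X w u < \<infinity>}"

definition risk_measure ::
  "'x :: topological_space set \<Rightarrow> ('x \<Rightarrow> real) \<Rightarrow> (('x \<Rightarrow> real) \<Rightarrow> real) \<Rightarrow> bool" where
  "risk_measure X w \<nu> \<longleftrightarrow>
     (\<forall>u\<in>wspace X w. \<forall>v\<in>wspace X w. (\<forall>x\<in>X. v x \<le> u x) \<longrightarrow> \<nu> v \<le> \<nu> u) \<and>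
     (\<forall>v\<in>wspace X w. \<forall>r. \<nu> (\<lambda>x. v x + r) = \<nu> v + r) \<and>
     \<nu> (\<lambda>_. 0) = 0"

definition risk_map ::
  "'x :: topological_space set \<Rightarrow> ('x \<Rightarrow> 'a :: topological_space set) \<Rightarrow> ('x \<Rightarrow> real) \<Rightarrow>
   ('x \<Rightarrow> 'a \<Rightarrow> ('x \<Rightarrow> real) \<Rightarrow> real) \<Rightarrow> bool" where
  "risk_map X F w \<R> \<longleftrightarrow>
     (\<forall>(x, a)\<in>Sigma X F. risk_measure X w (\<R> x a)) \<and>
     (\<forall>v\<in>wspace X w.
        (\<lambda>(x, a). \<R> x a v) \<in> borel_measurable (restrict_space borel (Sigma X F)))"

definition risk_sharp ::
  "'x :: topological_space set \<Rightarrow> ('x \<Rightarrow> real) \<Rightarrow> (('x \<Rightarrow> real) \<Rightarrow> real) \<Rightarrow> ('x \<Rightarrow> real) \<Rightarrow> ereal"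
where
  "risk_sharp X w \<nu> v = (SUP u\<in>wspace X w. ereal (\<nu> (\<lambda>x. v x + u x) - \<nu> u))"

text \<open>
  For \<open>l < 0\<close> an infinite numerator contributes \<open>-\<infinity>\<close> to the supremum.
\<close>

definition risk_sharp_bar ::
  "'x :: topological_space set \<Rightarrow> ('x \<Rightarrow> real) \<Rightarrow> (('x \<Rightarrow> real) \<Rightarrow> real) \<Rightarrow> ('x \<Rightarrow> real) \<Rightarrow> ereal"
where
  "risk_sharp_bar X w \<nu> v = (SUP l\<in>{l. l \<noteq> 0}. risk_sharp X w \<nu> (\<lambda>x. l * v x) / ereal l)"

definition lsc_on :: "'a :: topological_space set \<Rightarrow> ('a \<Rightarrow> real) \<Rightarrow> bool" where
  "lsc_on S f \<longleftrightarrow> (\<forall>a\<in>S. ereal (f a) \<le> Liminf (at a within S) (\<lambda>b. ereal (f b)))"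

end

theory Submission
  imports Defs
begin

text \<open>
  The right-hand side of the equation defines an operator \<open>T\<close> that commutes with adding constants.
  If \<open>\<bar>u - v\<bar> \<le> s w\<close> then \<open>(T u - T v) x - (T u - T v) y \<le> \<kappa> s (w x + w y)\<close> with \<open>\<kappa> < 1\<close>: for
  \<open>W x + W y \<ge> R\<close> this is the drift condition, and otherwise both states lie in \<open>B\<close>, where the
  minorization gains \<open>2 \<alpha> s\<close>. So \<open>T\<close> contracts the \<open>w\<close>-weighted span seminorm, and normalized
  iterates converge to a fixed point modulo constants.

  That \<open>T u\<close> is again Borel measurable rests on Novikov's theorem that a Borel set with compact
  sections has a Borel projection. It is derived from the separation of countable families of
  analytic sets with empty intersection, where analytic sets are represented as continuous images of
  Borel (or closed) subsets of Polish spaces.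
\<close>

section \<open>Borel sets with compact sections\<close>

instance prod :: (polish_space, polish_space) polish_space ..

lemma countable_dense_sequence:
  obtains d :: "nat \<Rightarrow> 'p :: second_countable_topology"
  where "\<And>U. open U \<Longrightarrow> U \<noteq> {} \<Longrightarrow> \<exists>j. d j \<in> U"
proof -
  obtain D :: "'p set" where D: "countable D" "\<And>U. open U \<Longrightarrow> U \<noteq> {} \<Longrightarrow> \<exists>d\<in>D. d \<in> U"
    by (rule countable_dense_setE) blast
  have "D \<noteq> {}"
    using D(2)[of UNIV] by auto
  then have "range (from_nat_into D) = D"
    using D(1) by (rule range_from_nat_into)
  then have "\<exists>j. from_nat_into D j \<in> U" if "open U" "U \<noteq> {}" for U
    using D(2)[OF that] by (metis imageE)
  then show ?thesis
    by (rule that)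
qed

text \<open>Trades a Borel set for a closed one at the price of an extra coordinate in Baire space.
  Projections of closed sets are stable under countable unions and intersections and include all
  open and closed sets, which suffices for an induction over the Borel sets.\<close>

lemma Borel_projection_of_closed:
  fixes P :: "'z :: metric_space set"
  assumes "P \<in> sets borel"
  shows "\<exists>C :: ('z \<times> (nat \<Rightarrow> nat discrete)) set. closed C \<and> P = fst ` C"
proof -
  define proj where "proj P \<longleftrightarrow> (\<exists>C :: ('z \<times> (nat \<Rightarrow> nat discrete)) set. closed C \<and> P = fst ` C)"
    for P :: "'z set"
  have coord: "continuous_on UNIV (\<lambda>p :: 'z \<times> (nat \<Rightarrow> nat discrete). snd p i)" for i
    by (rule continuous_on_product_then_coordinatewise[OF continuous_on_snd[OF continuous_on_id]])
  have closed: "proj P" if "closed P" for P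
  proof -
    have "closed (P \<times> (UNIV :: (nat \<Rightarrow> nat discrete) set))"
      using that by (intro closed_Times) auto
    moreover have "P = fst ` (P \<times> (UNIV :: (nat \<Rightarrow> nat discrete) set))"
      by auto
    ultimately show ?thesis
      unfolding proj_def by blast
  qed
  have proj_Union: "proj (\<Union>n. P n)" if "\<And>n. proj (P n)" for P :: "nat \<Rightarrow> 'z set"
  proof -
    from that obtain C :: "nat \<Rightarrow> ('z \<times> (nat \<Rightarrow> nat discrete)) set"
      where C: "\<And>n. closed (C n)" "\<And>n. P n = fst ` C n"
      unfolding proj_def by metis
    \<comment> \<open>Coordinate 0 of the sequence names the index \<open>n\<close>, and the shifted
      sequence is the witness for \<open>C n\<close>. Phrased as "coordinate 0 differs from
      \<open>n\<close>, or the shift lies in \<open>C n\<close>", each condition is closed, because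
      singletons are open.\<close>
    define s :: "'z \<times> (nat \<Rightarrow> nat discrete) \<Rightarrow> 'z \<times> (nat \<Rightarrow> nat discrete)"
      where "s p = (fst p, \<lambda>k. snd p (Suc k))" for p
    define U where "U = (\<Inter>n. (\<lambda>p. snd p 0) -` (- {discrete n}) \<union> s -` C n)"
    have "continuous_on UNIV s"
      unfolding s_def
      by (intro continuous_on_Pair continuous_on_fst continuous_on_id
            continuous_on_coordinatewise_then_product coord)
    moreover have "closed (- {discrete n})" for n :: nat
      by (simp add: closed_def open_discrete)
    ultimately have "closed U"
      unfolding U_def using C(1) coord
      by (intro closed_INT ballI closed_Un closed_vimage) auto
    moreover have "(\<Union>n. P n) = fst ` U"
    proof (intro equalityI subsetI)
      fix z assume "z \<in> (\<Union>n. P n)"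
      then obtain n t where "(z, t) \<in> C n"
        using C(2) by fastforce
      then have "(z, case_nat (discrete n) t) \<in> U"
        by (auto simp: U_def s_def discrete_inject)
      then show "z \<in> fst ` U"
        by force
    next
      fix z assume "z \<in> fst ` U"
      then obtain t where t: "(z, t) \<in> U"
        by auto
      define n where "n = of_discrete (t 0)"
      have "s (z, t) \<in> C n"
        using t by (auto simp: U_def n_def of_discrete_inverse)
      then have "z \<in> P n"
        using C(2) by (force simp: s_def)
      then show "z \<in> (\<Union>n. P n)"
        by auto
    qed
    ultimately show ?thesis
      unfolding proj_def by blast
  qed
  have proj_Inter: "proj (\<Inter>n. P n)" if "\<And>n. proj (P n)" for P :: "nat \<Rightarrow> 'z set"
  proof -
    from that obtain C :: "nat \<Rightarrow> ('z \<times> (nat \<Rightarrow> nat discrete)) set"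
      where C: "\<And>n. closed (C n)" "\<And>n. P n = fst ` C n"
      unfolding proj_def by metis
    \<comment> \<open>One sequence is read as countably many through \<open>prod_encode\<close>; the
      \<open>n\<close>-th of them is the witness for \<open>C n\<close>.\<close>
    define s :: "nat \<Rightarrow> 'z \<times> (nat \<Rightarrow> nat discrete) \<Rightarrow> 'z \<times> (nat \<Rightarrow> nat discrete)"
      where "s n p = (fst p, \<lambda>k. snd p (prod_encode (n, k)))" for n p
    define U where "U = (\<Inter>n. s n -` C n)"
    have "continuous_on UNIV (s n)" for n
      unfolding s_def
      by (intro continuous_on_Pair continuous_on_fst continuous_on_id
            continuous_on_coordinatewise_then_product coord)
    then have "closed U"
      unfolding U_def using C(1) by (intro closed_INT ballI closed_vimage) auto
    moreover have "(\<Inter>n. P n) = fst ` U"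
    proof (intro equalityI subsetI)
      fix z assume z: "z \<in> (\<Inter>n. P n)"
      have "\<forall>n. \<exists>t. (z, t) \<in> C n"
        using z C(2) by fastforce
      then obtain t where "\<And>n. (z, t n) \<in> C n"
        by metis
      then have "(z, \<lambda>m. case prod_decode m of (n, k) \<Rightarrow> t n k) \<in> U"
        by (auto simp: U_def s_def)
      then show "z \<in> fst ` U"
        by force
    next
      fix z assume "z \<in> fst ` U"
      then obtain t where t: "(z, t) \<in> U"
        by auto
      have "z \<in> P n" for n
        using t C(2)[of n] by (force simp: U_def s_def)
      then show "z \<in> (\<Inter>n. P n)"
        by auto
    qed
    ultimately show ?thesis
      unfolding proj_def by blast
  qed
  have "open": "proj U" if "open U" for U
  \<comment> \<open>An open set is the union of the closed sets of points at distance at least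
    \<open>1 / Suc n\<close> from its complement. The whole space stands apart because
    \<open>infdist\<close> to the empty set is 0 by convention.\<close>
  proof (cases "U = UNIV")
    case False
    define P where "P n = {x. 1 / real (Suc n) \<le> infdist x (- U)}" for n
    have "proj (P n)" for n
      unfolding P_def by (intro closed closed_Collect_le continuous_intros)
    moreover have "U = (\<Union>n. P n)"
    proof (intro equalityI subsetI)
      fix x assume "x \<in> U"
      then have "0 < infdist x (- U)"
        using that False by (intro infdist_pos_not_in_closed) auto
      then show "x \<in> (\<Union>n. P n)"
        by (rule nat_approx_posE) (auto simp: P_def intro: less_imp_le)
    next
      fix x assume "x \<in> (\<Union>n. P n)"
      then have "infdist x (- U) \<noteq> 0"
        by (auto simp: P_def not_le)
      then show "x \<in> U"
        by (metis ComplI infdist_zero)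
    qed
    ultimately show ?thesis
      using proj_Union by metis
  qed (auto intro: closed)
  \<comment> \<open>The complement belongs to the induction claim because projections of closed sets
    are in general not stable under complements.\<close>
  have "proj P \<and> proj (- P)"
    using assms unfolding sets_borel
  proof (induction rule: sigma_sets.induct)
    case (Basic a)
    then show ?case
      using "open"[of a] closed[of "- a"] by (auto intro: closed_Compl)
  next
    case Empty
    then show ?case
      using closed by auto
  next
    case (Compl a)
    then show ?case
      by (simp add: Compl_eq_Diff_UNIV[symmetric])
  next
    case (Union a)
    then show ?case
      using proj_Union[of a] proj_Inter[of "\<lambda>n. - a n"] by auto
  qed
  then show ?thesis
    unfolding proj_def by blast
qed

text \<open>
  If the family cannot be separated, then neither can one in which every set has been cut down to
  a small piece. In the limit all the pieces shrink to points; if two of the points have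
  different images, disjoint neighbourhoods of these separate the pieces after all.
\<close>

lemma Novikov_separation_closed:
  fixes f :: "nat \<Rightarrow> 'p :: polish_space \<Rightarrow> 'x :: t2_space"
  assumes C: "\<And>n. closed (C n)" and f: "\<And>n. continuous_on UNIV (f n)"
    and empty: "(\<Inter>n. f n ` C n) = {}"
  shows "\<exists>B. (\<forall>n. B n \<in> sets borel \<and> f n ` C n \<subseteq> B n) \<and> (\<Inter>n. B n) = {}"
proof (rule ccontr)
  define sep :: "(nat \<Rightarrow> 'x set) \<Rightarrow> bool"
    where "sep S \<longleftrightarrow> (\<exists>B. (\<forall>n. B n \<in> sets borel \<and> S n \<subseteq> B n) \<and> (\<Inter>n. B n) = {})" for S
  assume "\<not> ?thesis"
  then have nsep: "\<not> sep (\<lambda>n. f n ` C n)"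
    by (simp add: sep_def)
  \<comment> \<open>Separations for all the pieces \<open>T j\<close> of the \<open>k\<close>-th set
    combine into one: the \<open>k\<close>-th separators are united, those of every other set are
    intersected.\<close>
  have sep_Un: "sep S" if "\<And>j :: nat. sep (S(k := T j))" and "S k \<subseteq> (\<Union>j. T j)" for S k T
  proof -
    from that(1) obtain B where B: "\<And>j n. B j n \<in> sets borel"
        "\<And>j n. (S(k := T j)) n \<subseteq> B j n" "\<And>j. (\<Inter>n. B j n) = {}"
      unfolding sep_def by metis
    define B' where "B' n = (if n = k then \<Union>j. B j k else \<Inter>j. B j n)" for n
    have "B' n \<in> sets borel" for n
      unfolding B'_def using B(1) by auto
    moreover have "S n \<subseteq> B' n" for n
    proof (cases "n = k")
      case True
      then show ?thesis
        using that(2) B(2)[of _ k] by (fastforce simp: B'_def)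
    next
      case False
      then show ?thesis
        using B(2)[of _ n] by (fastforce simp: B'_def)
    qed
    moreover have "(\<Inter>n. B' n) = {}"
    proof (rule equals0I)
      fix x assume x: "x \<in> (\<Inter>n. B' n)"
      then have "x \<in> B' k"
        by blast
      then obtain j where j: "x \<in> B j k"
        by (auto simp: B'_def)
      have "x \<in> B j n" for n
        using x j by (cases "n = k") (auto simp: B'_def dest: INT_D[of _ _ _ n])
      then show False
        using B(3)[of j] by auto
    qed
    ultimately show ?thesis
      unfolding sep_def by blast
  qed
  \<comment> \<open>Step \<open>m\<close> cuts only the set with index
    \<open>fst (prod_decode m)\<close>. Every index is hit infinitely often, with radii tending to
    0, so all diameters shrink to 0.\<close>
  define step where "step m E E' \<longleftrightarrow> (\<exists>y. E' = E(fst (prod_decode m) :=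
      E (fst (prod_decode m)) \<inter> cball y (1 / real (Suc m))))" for m and E E' :: "nat \<Rightarrow> 'p set"
  obtain d :: "nat \<Rightarrow> 'p" where d: "\<And>U. open U \<Longrightarrow> U \<noteq> {} \<Longrightarrow> \<exists>j. d j \<in> U"
    using countable_dense_sequence by blast
  have "\<exists>E. \<forall>m. ((\<forall>n. closed (E m n)) \<and> \<not> sep (\<lambda>n. f n ` E m n) \<and> (m = 0 \<longrightarrow> E m = C)) \<and>
      step m (E m) (E (Suc m))"
  proof (rule dependent_nat_choice)
    show "\<exists>E. (\<forall>n. closed (E n)) \<and> \<not> sep (\<lambda>n. f n ` E n) \<and> (0 = (0 :: nat) \<longrightarrow> E = C)"
      using C nsep by blast
  next
    fix E :: "nat \<Rightarrow> 'p set" and m :: nat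
    assume E: "(\<forall>n. closed (E n)) \<and> \<not> sep (\<lambda>n. f n ` E n) \<and> (m = 0 \<longrightarrow> E = C)"
    define k where "k = fst (prod_decode m)"
    define r where "r = 1 / real (Suc m)"
    define E' where "E' j = E(k := E k \<inter> cball (d j) r)" for j
    have *: "(\<lambda>n. f n ` E' j n) = (\<lambda>n. f n ` E n)(k := f k ` (E k \<inter> cball (d j) r))" for j
      by (auto simp: E'_def fun_eq_iff)
    have "E k \<subseteq> (\<Union>j. E k \<inter> cball (d j) r)"
    proof
      fix y assume "y \<in> E k"
      moreover obtain j where "d j \<in> ball y r"
        using d[of "ball y r"] by (auto simp: r_def)
      ultimately show "y \<in> (\<Union>j. E k \<inter> cball (d j) r)"
        by (auto simp: dist_commute intro!: exI[of _ j])
    qed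
    then have "f k ` E k \<subseteq> (\<Union>j. f k ` (E k \<inter> cball (d j) r))"
      by blast
    then obtain j where "\<not> sep (\<lambda>n. f n ` E' j n)"
      using sep_Un[of "\<lambda>n. f n ` E n" k "\<lambda>j. f k ` (E k \<inter> cball (d j) r)"] E *
      by metis
    moreover have "step m E (E' j)"
      unfolding step_def E'_def k_def r_def by blast
    moreover have "closed (E' j n)" for n
      using E by (auto simp: E'_def)
    ultimately show "\<exists>E'. ((\<forall>n. closed (E' n)) \<and> \<not> sep (\<lambda>n. f n ` E' n) \<and> (Suc m = 0 \<longrightarrow> E' = C)) \<and>
        step m E E'"
      by auto
  qed
  then obtain E where E: "\<And>m n. closed (E m n)" "\<And>m. \<not> sep (\<lambda>n. f n ` E m n)" "E 0 = C"
      "\<And>m. step m (E m) (E (Suc m))"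
    by metis
  have decr: "E m n \<subseteq> E l n" if "l \<le> m" for l m n
    using that
  proof (induction rule: dec_induct)
    case (step m)
    then show ?case
      using E(4)[of m] by (fastforce simp: step_def split: if_splits)
  qed simp
  have small: "\<exists>m. \<forall>x\<in>E m n. \<forall>y\<in>E m n. dist x y < e" if "0 < e" for n and e :: real
  proof -
    have "0 < e / 2"
      using that by simp
    then obtain i where i: "1 / real (Suc i) < e / 2"
      by (rule nat_approx_posE)
    define m where "m = prod_encode (n, i)"
    have "1 / real (Suc m) \<le> 1 / real (Suc i)"
      unfolding m_def by (intro divide_left_mono) (auto simp: le_prod_encode_2)
    then have m: "1 / real (Suc m) < e / 2"
      using i by simp
    have "fst (prod_decode m) = n"
      by (simp add: m_def)
    then obtain y where "E (Suc m) = (E m)(n := E m n \<inter> cball y (1 / real (Suc m)))"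
      using E(4)[of m] unfolding step_def by metis
    then have y: "E (Suc m) n \<subseteq> cball y (1 / real (Suc m))"
      by simp
    have "dist a b < e" if "a \<in> E (Suc m) n" "b \<in> E (Suc m) n" for a b
    proof -
      have "dist y a < e / 2" "dist y b < e / 2"
        using that y m by fastforce+
      then show ?thesis
        by (rule dist_triangle_half_r)
    qed
    then show ?thesis
      by blast
  qed
  \<comment> \<open>If one piece were empty, \<open>{}\<close> at its index and \<open>UNIV\<close>
    elsewhere would separate the family.\<close>
  have nonempty: "E m n \<noteq> {}" for m n
  proof
    assume "E m n = {}"
    then have "sep (\<lambda>n. f n ` E m n)"
      unfolding sep_def by (intro exI[of _ "\<lambda>k. if k = n then {} else UNIV"]) auto
    then show False
      using E(2) by blast
  qed
  have "\<exists>p. \<forall>m. p \<in> E m n" for n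
    by (rule decreasing_closed_nest[of "\<lambda>m. E m n"]) (use E(1) nonempty decr small in auto)
  then obtain p where p: "\<And>m n. p n \<in> E m n"
    by metis
  obtain i j where ij: "f i (p i) \<noteq> f j (p j)"
  proof -
    have "f 0 (p 0) \<notin> (\<Inter>n. f n ` C n)"
      using empty by auto
    then obtain n where "f 0 (p 0) \<notin> f n ` C n"
      by auto
    then have "f 0 (p 0) \<noteq> f n (p n)"
      using p[of n 0] E(3) by auto
    then show ?thesis
      by (rule that)
  qed
  obtain U V where UV: "open U" "open V" "f i (p i) \<in> U" "f j (p j) \<in> V" "U \<inter> V = {}"
    using hausdorff[OF ij] by blast
  have shrink: "\<exists>m. f n ` E m n \<subseteq> U" if "open U" "f n (p n) \<in> U" for n U
  proof -
    note U = that
    have "open (f n -` U)"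
      using f U(1) by (metis open_vimage)
    then obtain e where e: "0 < e" "ball (p n) e \<subseteq> f n -` U"
      using U(2) by (metis open_contains_ball vimageI)
    obtain m where "\<forall>x\<in>E m n. \<forall>y\<in>E m n. dist x y < e"
      using small[OF e(1)] by blast
    then have "E m n \<subseteq> ball (p n) e"
      using p by auto
    then show ?thesis
      using e(2) by blast
  qed
  obtain m1 m2 where m: "f i ` E m1 i \<subseteq> U" "f j ` E m2 j \<subseteq> V"
    using shrink UV by metis
  define m where "m = max m1 m2"
  have "f i ` E m i \<subseteq> U" "f j ` E m j \<subseteq> V"
    using image_mono[OF decr[of m1 m i], of "f i"] image_mono[OF decr[of m2 m j], of "f j"] m
    by (auto simp: m_def)
  moreover have "i \<noteq> j"
    using ij by blast
  ultimately have "sep (\<lambda>n. f n ` E m n)"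
    unfolding sep_def using UV
    by (intro exI[of _ "\<lambda>n. if n = i then U else if n = j then V else UNIV"])
       (auto split: if_splits)
  then show False
    using E(2) by blast
qed

text \<open>Each Borel set is the projection of a closed subset of a product with Baire space.
  Composing \<open>f n\<close> with \<open>fst\<close> keeps the images and reduces the claim to
  closed sets.\<close>

lemma Novikov_separation:
  fixes f :: "nat \<Rightarrow> 'q :: polish_space \<Rightarrow> 'x :: t2_space"
  assumes P: "\<And>n. P n \<in> sets borel" and f: "\<And>n. continuous_on UNIV (f n)"
    and empty: "(\<Inter>n. f n ` P n) = {}"
  obtains B where "\<And>n. B n \<in> sets borel" "\<And>n. f n ` P n \<subseteq> B n" "(\<Inter>n. B n) = {}"
proof -
  have "\<forall>n. \<exists>C :: ('q \<times> (nat \<Rightarrow> nat discrete)) set. closed C \<and> P n = fst ` C"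
    using Borel_projection_of_closed[OF P] by blast
  then obtain C :: "nat \<Rightarrow> ('q \<times> (nat \<Rightarrow> nat discrete)) set"
    where C: "\<And>n. closed (C n)" "\<And>n. P n = fst ` C n"
    by metis
  have "\<exists>B. (\<forall>n. B n \<in> sets borel \<and> (\<lambda>z. f n (fst z)) ` C n \<subseteq> B n) \<and> (\<Inter>n. B n) = {}"
  proof (rule Novikov_separation_closed[of C "\<lambda>n z. f n (fst z)"])
    show "closed (C n)" for n
      by (rule C)
    show "continuous_on UNIV (\<lambda>z :: 'q \<times> (nat \<Rightarrow> nat discrete). f n (fst z))" for n
      by (rule continuous_on_compose2[OF f]) (auto intro: continuous_intros)
    show "(\<Inter>n. (\<lambda>z. f n (fst z)) ` C n) = {}"
      using empty C(2) by (simp add: image_image)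
  qed
  then show ?thesis
    using that C(2) by (metis image_image)
qed

text \<open>Novikov separation of the sequence \<open>P\<close>, \<open>S\<close>, \<open>S\<close>,
  and so on: all separators but the first contain the image of \<open>S\<close>, so the first one is
  disjoint from it.\<close>

lemma Lusin_separation:
  fixes f g :: "'q :: polish_space \<Rightarrow> 'x :: t2_space"
  assumes "P \<in> sets borel" "S \<in> sets borel" "continuous_on UNIV f" "continuous_on UNIV g"
    and disj: "f ` P \<inter> g ` S = {}"
  obtains B where "B \<in> sets borel" "f ` P \<subseteq> B" "B \<inter> g ` S = {}"
proof -
  define P' where "P' n = (if n = 0 then P else S)" for n :: nat
  define f' where "f' n = (if n = 0 then f else g)" for n :: nat
  have "(\<Inter>n. f' n ` P' n) \<subseteq> f' 0 ` P' 0 \<inter> f' 1 ` P' 1"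
    by blast
  then have "(\<Inter>n. f' n ` P' n) = {}"
    using disj by (simp add: P'_def f'_def)
  then obtain B where B: "\<And>n. B n \<in> sets borel" "\<And>n. f' n ` P' n \<subseteq> B n" "(\<Inter>n. B n) = {}"
    by (rule Novikov_separation[of P' f', rotated 2]) (use assms in \<open>auto simp: P'_def f'_def\<close>)
  have 1: "f ` P \<subseteq> B 0"
    using B(2)[of 0] by (simp add: P'_def f'_def)
  have 2: "g ` S \<subseteq> B (Suc n)" for n
    using B(2)[of "Suc n"] by (simp add: P'_def f'_def)
  have 3: "B 0 \<inter> (\<Inter>n. B (Suc n)) = {}"
  proof (rule equals0I)
    fix x assume "x \<in> B 0 \<inter> (\<Inter>n. B (Suc n))"
    then have "x \<in> B n" for n
      by (cases n) auto
    then show False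
      using B(3) by blast
  qed
  show ?thesis
  proof (rule that)
    show "B 0 \<in> sets borel"
      by (rule B)
    show "f ` P \<subseteq> B 0"
      by (rule 1)
    show "B 0 \<inter> g ` S = {}"
      using 2 3 by blast
  qed
qed

section \<open>Borel sets with open sections\<close>

lemma Borel_vimage:
  assumes "continuous_on UNIV g" "S \<in> sets borel"
  shows "g -` S \<in> sets borel"
  using measurable_sets[OF borel_measurable_continuous_onI[OF assms(1)] assms(2)] by simp

lemma Borel_Times:
  fixes S :: "'x :: second_countable_topology set" and T :: "'y :: second_countable_topology set"
  assumes "S \<in> sets borel" "T \<in> sets borel"
  shows "S \<times> T \<in> sets borel"
  unfolding borel_prod[symmetric] using assms by (rule pair_measureI)

text \<open>By openness, \<open>D\<close> is the union over basic sets \<open>V n\<close> of the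
  points \<open>(x, y)\<close> with \<open>y\<close> in \<open>V n\<close> and \<open>V n\<close>
  inside the section at \<open>x\<close>. Failure of this condition is analytic, so Novikov
  separation gives Borel sets \<open>D - M n\<close> that satisfy it and cover \<open>D\<close>.
  Lusin separation then encloses the projection of \<open>D - M n\<close> in a Borel set
  \<open>B n\<close> over which \<open>V n\<close> stays inside the sections.\<close>

lemma Borel_open_sections_Un_rectangles:
  fixes D :: "('x :: polish_space \<times> 'y :: polish_space) set"
  assumes D: "D \<in> sets borel" and sections: "\<And>x. open (Pair x -` D)"
  obtains B V where "\<And>n :: nat. B n \<in> sets borel" "\<And>n. open (V n)" "D = (\<Union>n. B n \<times> V n)"
proof -
  obtain V :: "nat \<Rightarrow> 'y set" where V: "\<And>n. open (V n)"
      "\<And>S y. open S \<Longrightarrow> y \<in> S \<Longrightarrow> \<exists>n. y \<in> V n \<and> V n \<subseteq> S"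
  proof -
    obtain \<B> :: "'y set set" where \<B>: "countable \<B>" "topological_basis \<B>"
      using ex_countable_basis by auto
    have "\<B> \<noteq> {}"
      using topological_basisE[OF \<B>(2), of UNIV] by blast
    then have range: "range (from_nat_into \<B>) = \<B>"
      using \<B>(1) by (rule range_from_nat_into)
    show ?thesis
    proof (rule that[of "from_nat_into \<B>"])
      show "open (from_nat_into \<B> n)" for n
        using topological_basis_open[OF \<B>(2)] range by blast
      show "\<exists>n. y \<in> from_nat_into \<B> n \<and> from_nat_into \<B> n \<subseteq> S" if "open S" "y \<in> S" for S y
        using topological_basisE[OF \<B>(2) that] range by (metis rangeE)
    qed
  qed
  define g :: "('x \<times> 'y) \<times> 'y \<Rightarrow> 'x \<times> 'y" where "g = (\<lambda>((x, y), y'). (x, y'))"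
  have g: "continuous_on UNIV g"
    unfolding g_def case_prod_unfold by (intro continuous_intros)
  have fst: "continuous_on UNIV (fst :: 'p :: topological_space \<times> 'q :: topological_space \<Rightarrow> 'p)"
    by (intro continuous_intros)
  have snd: "continuous_on UNIV (snd :: 'p :: topological_space \<times> 'q :: topological_space \<Rightarrow> 'q)"
    by (intro continuous_intros)
  \<comment> \<open>The image of \<open>P n\<close> under \<open>fst\<close> consists of the points
    \<open>(x, y)\<close> of \<open>D\<close> such that \<open>y\<close> is outside
    \<open>V n\<close> or some \<open>y'\<close> in \<open>V n\<close> is outside the section at
    \<open>x\<close>; the last coordinate holds \<open>y'\<close>.\<close>
  define P where "P n = fst -` D \<inter> (fst -` snd -` (- V n) \<union> g -` (- D) \<inter> snd -` V n)"
    for n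
  have "P n \<in> sets borel" for n
    unfolding P_def using D V(1)
    by (intro sets.Int sets.Un Borel_vimage[OF fst] Borel_vimage[OF snd] Borel_vimage[OF g] borel_comp)
       auto
  moreover have "(\<Inter>n. fst ` P n) = {}"
  proof (rule equals0I)
    fix z assume z: "z \<in> (\<Inter>n. fst ` P n)"
    obtain x y where xy: "z = (x, y)"
      by fastforce
    have "y \<in> Pair x -` D"
      using z by (auto simp: P_def xy)
    then obtain n where n: "y \<in> V n" "V n \<subseteq> Pair x -` D"
      using V(2) sections by metis
    have "z \<in> fst ` P n"
      using z by blast
    then show False
      using n by (auto simp: P_def xy g_def)
  qed
  ultimately obtain M where M: "\<And>n. M n \<in> sets borel" "\<And>n. fst ` P n \<subseteq> M n" "(\<Inter>n. M n) = {}"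
    using Novikov_separation[OF _ fst, of P] by metis
  have M_V: "y \<in> V n \<and> V n \<subseteq> Pair x -` D" if "(x, y) \<in> D - M n" for x y n
  proof -
    have "((x, y), y') \<notin> P n" for y'
      using that M(2)[of n] by force
    then show ?thesis
      using that by (auto simp: P_def g_def)
  qed
  have "\<exists>B. B \<in> sets borel \<and> fst ` (D - M n) \<subseteq> B \<and> B \<inter> fst ` (- D \<inter> UNIV \<times> V n) = {}" for n
  proof (rule Lusin_separation[of "D - M n" "- D \<inter> UNIV \<times> V n" fst fst])
    show "- D \<inter> UNIV \<times> V n \<in> sets borel"
      using D V(1) by (intro sets.Int borel_comp Borel_Times) auto
    show "fst ` (D - M n) \<inter> fst ` (- D \<inter> UNIV \<times> V n) = {}"
      using M_V[of _ _ n] by fastforce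
  qed (use D M(1) fst in auto)
  then obtain B where B: "\<And>n. B n \<in> sets borel" "\<And>n. fst ` (D - M n) \<subseteq> B n"
      "\<And>n. B n \<inter> fst ` (- D \<inter> UNIV \<times> V n) = {}"
    by metis
  show ?thesis
  proof (rule that[of B V])
    show "D = (\<Union>n. B n \<times> V n)"
    proof (intro equalityI subsetI)
      fix z assume z: "z \<in> D"
      obtain x y where xy: "z = (x, y)"
        by fastforce
      obtain n where n: "z \<notin> M n"
        using M(3) by blast
      then have "x \<in> B n" "y \<in> V n"
        using z B(2)[of n] M_V[of x y n] by (force simp: xy)+
      then show "z \<in> (\<Union>n. B n \<times> V n)"
        by (auto simp: xy)
    next
      fix z assume "z \<in> (\<Union>n. B n \<times> V n)"
      then obtain n x y where xy: "z = (x, y)" "x \<in> B n" "y \<in> V n"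
        by auto
      have "x \<notin> fst ` (- D \<inter> UNIV \<times> V n)"
        using B(3)[of n] xy(2) by blast
      then show "z \<in> D"
        using xy by force
    qed
  qed (use B V in auto)
qed

section \<open>Projections of Borel sets with compact sections\<close>

text \<open>Pick \<open>y m\<close> meeting the conditions with index up to \<open>m\<close>. For
  each \<open>i\<close> in \<open>I\<close> all but finitely many \<open>y m\<close> lie in
  \<open>G i\<close>, so \<open>small\<close> makes the range totally bounded, and the limit of a
  subsequence lies in every \<open>G i\<close>.\<close>

lemma compact_fip_totally_bounded:
  fixes G :: "nat \<Rightarrow> 'y :: complete_space set"
  assumes G: "\<And>i. i \<in> I \<Longrightarrow> closed (G i)"
    and small: "\<And>e :: real. 0 < e \<Longrightarrow> \<exists>i\<in>I. \<exists>k. finite k \<and> G i \<subseteq> (\<Union>y\<in>k. ball y e)"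
    and fip: "\<And>m. (\<Inter>i\<in>I \<inter> {..m}. G i) \<noteq> {}"
  shows "(\<Inter>i\<in>I. G i) \<noteq> {}"
proof -
  obtain y where y: "\<And>m. y m \<in> (\<Inter>i\<in>I \<inter> {..m}. G i)"
    using fip unfolding ex_in_conv[symmetric] by metis
  have tail: "y m \<in> G i" if "i \<in> I" "i \<le> m" for i m
    using y[of m] that by auto
  have "\<exists>k. finite k \<and> closure (range y) \<subseteq> (\<Union>x\<in>k. ball x e)" if "0 < e" for e :: real
  proof -
    from that have "0 < e / 2"
      by simp
    then obtain i k where i: "i \<in> I" and k: "finite k" "G i \<subseteq> (\<Union>x\<in>k. ball x (e / 2))"
      using small[of "e / 2"] by auto
    define k' where "k' = k \<union> y ` {..<i}"
    have "range y \<subseteq> (\<Union>x\<in>k'. cball x (e / 2))"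
    proof safe
      fix m
      show "y m \<in> (\<Union>x\<in>k'. cball x (e / 2))"
      proof (cases "m < i")
        case True
        then show ?thesis
          using that by (intro UN_I[of "y m"]) (auto simp: k'_def)
      next
        case False
        then have "y m \<in> (\<Union>x\<in>k. ball x (e / 2))"
          using tail[OF i(1), of m] subsetD[OF k(2)] by simp
        then show ?thesis
          by (force simp: k'_def)
      qed
    qed
    moreover have "finite k'"
      using k(1) by (simp add: k'_def)
    ultimately have "closure (range y) \<subseteq> (\<Union>x\<in>k'. cball x (e / 2))"
      by (intro closure_minimal closed_UN) auto
    also have "\<dots> \<subseteq> (\<Union>x\<in>k'. ball x e)"
      using that by (intro UN_mono) auto
    finally show ?thesis
      using \<open>finite k'\<close> by blast
  qed
  then have "compact (closure (range y))"
    by (simp add: compact_eq_totally_bounded complete_eq_closed)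
  then have "seq_compact (closure (range y))"
    by (simp add: compact_imp_seq_compact)
  moreover have "\<forall>n. y n \<in> closure (range y)"
    by (meson closure_subset rangeI subsetD)
  ultimately obtain l r where l: "strict_mono (r :: nat \<Rightarrow> nat)" "(y \<circ> r) \<longlonglongrightarrow> l"
    unfolding seq_compact_def by blast
  have "l \<in> G i" if i: "i \<in> I" for i
  proof (rule Lim_in_closed_set[OF G[OF i] _ sequentially_bot l(2)])
    have "(y \<circ> r) n \<in> G i" if "i \<le> n" for n
      using tail[OF i order_trans[OF that seq_suble[OF l(1)]]] by simp
    then show "\<forall>\<^sub>F n in sequentially. (y \<circ> r) n \<in> G i"
      by (rule eventually_sequentiallyI)
  qed
  then show ?thesis
    by blast
qed

text \<open>
  Up to countable Boolean operations with Borel sets of states, \<open>D\<close> is a countable intersection of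
  sets \<open>{(x, y). x \<in> B i \<or> y \<in> G i}\<close>. Among these, some have totally bounded sections, so that
  compactness makes the projection commute with the intersection.
\<close>

lemma Novikov_projection:
  fixes D :: "('x :: polish_space \<times> 'y :: polish_space) set"
  assumes D: "D \<in> sets borel" and sections: "\<And>x. compact (Pair x -` D)"
  shows "fst ` D \<in> sets borel"
proof -
  obtain d :: "nat \<Rightarrow> 'y" where d: "\<And>U. open U \<Longrightarrow> U \<noteq> {} \<Longrightarrow> \<exists>j. d j \<in> U"
    using countable_dense_sequence by blast
  define r where "r k = 1 / real (Suc k)" for k
  have r: "0 < r k" for k
    by (simp add: r_def)
  \<comment> \<open>For fixed \<open>k\<close>, compactness puts each section of \<open>D\<close>
    inside some \<open>G k n\<close>. Hence the sets of states whose section leaves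
    \<open>G k n\<close> have empty intersection over \<open>n\<close>, and Novikov separation
    encloses them in Borel sets \<open>N k n\<close> with the same property.\<close>
  define G where "G k n = (\<Union>j\<le>n. cball (d j) (r k))" for k n :: nat
  have closed_G: "closed (G k n)" for k n
    unfolding G_def by auto
  have fst: "continuous_on UNIV (fst :: 'x \<times> 'y \<Rightarrow> 'x)"
    by (intro continuous_intros)
  have "\<exists>B. (\<forall>n. B n \<in> sets borel) \<and> (\<forall>n. fst ` (D - UNIV \<times> G k n) \<subseteq> B n) \<and> (\<Inter>n. B n) = {}" for k
  proof (rule Novikov_separation[of "\<lambda>n. D - UNIV \<times> G k n" "\<lambda>_. fst"])
    show "D - UNIV \<times> G k n \<in> sets borel" for n
      using D closed_G by (intro sets.Diff Borel_Times) auto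
    show "(\<Inter>n. fst ` (D - UNIV \<times> G k n)) = {}"
    proof (rule equals0I)
      fix x assume x: "x \<in> (\<Inter>n. fst ` (D - UNIV \<times> G k n))"
      have "Pair x -` D \<subseteq> (\<Union>j. ball (d j) (r k))"
      proof
        fix y
        obtain j where "d j \<in> ball y (r k)"
          using d[of "ball y (r k)"] r[of k] by auto
        then show "y \<in> (\<Union>j. ball (d j) (r k))"
          by (auto simp: dist_commute)
      qed
      then obtain J where J: "finite J" "Pair x -` D \<subseteq> (\<Union>j\<in>J. ball (d j) (r k))"
        using compactE_image[OF sections[of x], of UNIV "\<lambda>j. ball (d j) (r k)"] by auto
      note J(2)
      also have "(\<Union>j\<in>J. ball (d j) (r k)) \<subseteq> G k (Max J)"
        using Max_ge[OF J(1)] by (fastforce simp: G_def intro: less_imp_le)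
      finally have "x \<notin> fst ` (D - UNIV \<times> G k (Max J))"
        by force
      then show False
        using x by blast
    qed
  qed (use fst in blast)+
  then obtain N where N: "\<And>k n. N k n \<in> sets borel" "\<And>k n. fst ` (D - UNIV \<times> G k n) \<subseteq> N k n"
      "\<And>k. (\<Inter>n. N k n) = {}"
    by metis
  have "open (Pair x -` (- D))" for x
    using compact_imp_closed[OF sections[of x]] by (simp add: vimage_Compl open_Compl)
  then obtain M V where M: "\<And>n :: nat. M n \<in> sets borel" and V: "\<And>n. open (V n)"
    and MV: "- D = (\<Union>n. M n \<times> V n)"
    by (rule Borel_open_sections_Un_rectangles[OF borel_comp[OF D]]) blast
  \<comment> \<open>Two families of conditions merge into one sequence: \<open>Inl\<close> says that
    the section lies in \<open>G k n\<close> unless \<open>x\<close> is in \<open>N k n\<close>,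
    \<open>Inr\<close> that it avoids \<open>V n\<close> unless \<open>x\<close> is outside
    \<open>M n\<close>. Below, \<open>I x\<close> collects the conditions in force at
    \<open>x\<close>.\<close>
  define B where "B i = (case sum_decode i of Inl j \<Rightarrow> (case prod_decode j of (k, n) \<Rightarrow> N k n)
      | Inr n \<Rightarrow> - M n)" for i
  define H where "H i = (case sum_decode i of Inl j \<Rightarrow> (case prod_decode j of (k, n) \<Rightarrow> G k n)
      | Inr n \<Rightarrow> - V n)" for i
  have B: "B i \<in> sets borel" for i
    using N(1) M by (auto simp: B_def split: sum.split prod.split)
  have H: "closed (H i)" for i
    using closed_G V by (auto simp: H_def split: sum.split prod.split)
  have D_sub: "y \<in> H i" if "(x, y) \<in> D" "x \<notin> B i" for x y i
  proof (cases "sum_decode i")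
    case (Inl j)
    obtain k n where kn: "prod_decode j = (k, n)"
      by fastforce
    show ?thesis
      using that N(2)[of k n] by (force simp: B_def H_def Inl kn)
  next
    case (Inr n)
    then show ?thesis
      using that MV by (auto simp: B_def H_def)
  qed
  define I where "I x = {i. x \<notin> B i}" for x
  have section_eq: "(\<Inter>i\<in>I x. H i) = Pair x -` D" for x
  proof (intro equalityI subsetI)
    fix y assume y: "y \<in> (\<Inter>i\<in>I x. H i)"
    show "y \<in> Pair x -` D"
    proof (rule ccontr)
      assume "y \<notin> Pair x -` D"
      then have "(x, y) \<in> (\<Union>n. M n \<times> V n)"
        using MV by auto
      then obtain n where n: "x \<in> M n" "y \<in> V n"
        by auto
      then have "sum_encode (Inr n) \<in> I x" "y \<notin> H (sum_encode (Inr n))"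
        by (auto simp: I_def B_def H_def)
      then show False
        using y by blast
    qed
  qed (use D_sub in \<open>auto simp: I_def\<close>)
  have small: "\<exists>i\<in>I x. \<exists>k. finite k \<and> H i \<subseteq> (\<Union>y\<in>k. ball y e)" if "0 < e" for x and e :: real
  proof -
    obtain k where k: "r k < e"
      unfolding r_def using \<open>0 < e\<close> by (rule nat_approx_posE)
    obtain n where n: "x \<notin> N k n"
      using N(3)[of k] by blast
    define i where "i = sum_encode (Inl (prod_encode (k, n)))"
    have "i \<in> I x"
      using n by (simp add: I_def i_def B_def)
    moreover have "H i \<subseteq> (\<Union>y\<in>d ` {..n}. ball y e)"
      using k by (force simp: H_def i_def G_def)
    ultimately show ?thesis
      by blast
  qed
  have "(x \<in> fst ` D) = (\<forall>m. (\<Inter>i\<in>I x \<inter> {..m}. H i) \<noteq> {})" for x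
  proof -
    have "x \<in> fst ` D \<longleftrightarrow> (\<Inter>i\<in>I x. H i) \<noteq> {}"
      unfolding section_eq by force
    also have "\<dots> \<longleftrightarrow> (\<forall>m. (\<Inter>i\<in>I x \<inter> {..m}. H i) \<noteq> {})"
      using compact_fip_totally_bounded[of "I x" H] H small[of _ x] by blast
    finally show ?thesis .
  qed
  then have "fst ` D = (\<Inter>m. {x. (\<Inter>i\<in>I x \<inter> {..m}. H i) \<noteq> {}})"
    by auto
  \<comment> \<open>The condition depends on \<open>x\<close> only through the finite set
    \<open>I x \<inter> {..m}\<close>. Sorting by its value yields a finite union of Boolean
    combinations of the Borel sets \<open>B i\<close>.\<close>
  also have "\<dots> = (\<Inter>m. \<Union>S\<in>{S. S \<subseteq> {..m} \<and> (\<Inter>i\<in>S. H i) \<noteq> {}}. {x. I x \<inter> {..m} = S})"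
    by auto
  also have "\<dots> \<in> sets borel"
  proof -
    have "(\<Union>S\<in>{S. S \<subseteq> {..m} \<and> (\<Inter>i\<in>S. H i) \<noteq> {}}. {x. I x \<inter> {..m} = S}) \<in> sets borel" for m
    proof (rule sets.finite_UN)
      show "finite {S. S \<subseteq> {..m} \<and> (\<Inter>i\<in>S. H i) \<noteq> {}}"
        by (rule finite_subset[of _ "Pow {..m}"]) auto
      fix S assume S: "S \<in> {S. S \<subseteq> {..m} \<and> (\<Inter>i\<in>S. H i) \<noteq> {}}"
      have "{x. I x \<inter> {..m} = S} = (\<Inter>i\<in>{..m}. if i \<in> S then - B i else B i)"
        using S by (auto simp: I_def split: if_splits)
      also have "\<dots> \<in> sets borel"
        using B by (intro sets.finite_INT) auto
      finally show "{x. I x \<inter> {..m} = S} \<in> sets borel" .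
    qed
    then show ?thesis
      by (intro sets.countable_INT) auto
  qed
  finally show ?thesis .
qed

section \<open>Infima of lower semicontinuous functions\<close>

lemma lsc_on_iff:
  "lsc_on S f \<longleftrightarrow> (\<forall>a\<in>S. \<forall>q<f a. \<forall>\<^sub>F b in at a within S. q < f b)"
proof -
  have "ereal (f a) \<le> Liminf F (\<lambda>b. ereal (f b)) \<longleftrightarrow> (\<forall>q<f a. \<forall>\<^sub>F b in F. q < f b)"
    for a and F :: "'a filter"
  proof
    assume le: "ereal (f a) \<le> Liminf F (\<lambda>b. ereal (f b))"
    have "\<forall>\<^sub>F b in F. ereal q < ereal (f b)" if "q < f a" for q
      using le_Liminf_iff[THEN iffD1, OF le, rule_format, of "ereal q"] that by simp
    then show "\<forall>q<f a. \<forall>\<^sub>F b in F. q < f b"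
      by simp
  next
    assume *: "\<forall>q<f a. \<forall>\<^sub>F b in F. q < f b"
    have lt: "\<forall>\<^sub>F b in F. y < ereal (f b)" if y: "y < ereal (f a)" for y
    proof (cases y)
      case (real q)
      then show ?thesis
        using y *[rule_format, of q] by simp
    next
      case PInf
      then show ?thesis
        using y by simp
    next
      case MInf
      then show ?thesis
        by simp
    qed
    show "ereal (f a) \<le> Liminf F (\<lambda>b. ereal (f b))"
      by (intro le_Liminf_iff[THEN iffD2] allI impI lt)
  qed
  then show ?thesis
    by (simp only: lsc_on_def)
qed

lemma lsc_on_add_continuous:
  assumes f: "lsc_on S f" and g: "continuous_on S g"
  shows "lsc_on S (\<lambda>a. f a + g a)"
  unfolding lsc_on_iff
proof (intro ballI allI impI)
  fix a q assume a: "a \<in> S" and q: "q < f a + g a"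
  define e where "e = (f a + g a - q) / 2"
  have "0 < e"
    using q by (simp add: e_def)
  then have "f a - e < f a" "g a - e < g a"
    by auto
  have "\<forall>\<^sub>F b in at a within S. f a - e < f b"
    using f a \<open>f a - e < f a\<close> unfolding lsc_on_iff by blast
  moreover have "\<forall>\<^sub>F b in at a within S. g a - e < g b"
    using g a \<open>g a - e < g a\<close> by (auto simp: continuous_on_def intro: order_tendstoD(1))
  ultimately show "\<forall>\<^sub>F b in at a within S. q < f b + g b"
    by eventually_elim (simp add: e_def field_simps)
qed

lemma lsc_on_compact_sublevel:
  fixes S :: "'a :: t2_space set"
  assumes S: "compact S" and f: "lsc_on S f"
  shows "compact {a \<in> S. f a \<le> q}"
proof -
  have "openin (top_of_set S) {a \<in> S. q < f a}"
  proof (subst openin_subopen, intro ballI)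
    fix a assume a: "a \<in> {a \<in> S. q < f a}"
    then have "\<forall>\<^sub>F b in at a within S. q < f b"
      using f unfolding lsc_on_iff by blast
    then obtain U where "open U" "a \<in> U" "\<forall>b\<in>U. b \<noteq> a \<longrightarrow> b \<in> S \<longrightarrow> q < f b"
      unfolding eventually_at_topological by blast
    then show "\<exists>T. openin (top_of_set S) T \<and> a \<in> T \<and> T \<subseteq> {a \<in> S. q < f a}"
      using a by (intro exI[of _ "S \<inter> U"]) (auto simp: openin_open)
  qed
  then have "closedin (top_of_set S) (S - {a \<in> S. q < f a})"
    by (simp add: closedin_diff)
  moreover have "S - {a \<in> S. q < f a} = {a \<in> S. f a \<le> q}"
    by auto
  ultimately show ?thesis
    using closedin_compact[OF S] by metis
qed

text \<open>The infimum is below \<open>r\<close> exactly if some action has value at most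
  \<open>q\<close> for a rational \<open>q < r\<close>. With the weak inequality, lower
  semicontinuity makes the sections compact, so Novikov's projection theorem applies for each
  \<open>q\<close>.\<close>

lemma borel_measurable_INF_compact:
  fixes F :: "'x :: polish_space \<Rightarrow> 'a :: polish_space set"
  assumes E: "Sigma X F \<in> sets borel"
    and f: "(\<lambda>(x, a). f x a) \<in> borel_measurable (restrict_space borel (Sigma X F))"
    and F: "\<And>x. x \<in> X \<Longrightarrow> F x \<noteq> {}" "\<And>x. x \<in> X \<Longrightarrow> compact (F x)"
    and lsc: "\<And>x. x \<in> X \<Longrightarrow> lsc_on (F x) (f x)"
    and bdd: "\<And>x. x \<in> X \<Longrightarrow> bdd_below (f x ` F x)"
  shows "(\<lambda>x. INF a\<in>F x. f x a) \<in> borel_measurable (restrict_space borel X)"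
  unfolding borel_measurable_iff_less
proof
  fix r :: real
  define D where "D q = {z \<in> Sigma X F. f (fst z) (snd z) \<le> q}" for q
  have Borel: "fst ` D q \<in> sets borel" for q
  proof (rule Novikov_projection)
    have "D q \<in> sets (restrict_space borel (Sigma X F))"
      using borel_measurable_le[OF f borel_measurable_const[of q]]
      by (simp add: D_def space_restrict_space case_prod_unfold)
    then show "D q \<in> sets borel"
      using E by (simp add: sets_restrict_space_iff)
    show "compact (Pair x -` D q)" for x
    proof (cases "x \<in> X")
      case True
      then have "Pair x -` D q = {a \<in> F x. f x a \<le> q}"
        by (auto simp: D_def)
      then show ?thesis
        using lsc_on_compact_sublevel[OF F(2) lsc] True by metis
    next
      case False
      then have "Pair x -` D q = {}"
        by (auto simp: D_def)
      then show ?thesis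
        by simp
    qed
  qed
  have "x \<in> (\<Union>q\<in>{q \<in> \<rat>. q < r}. fst ` D q) \<longleftrightarrow> x \<in> X \<and> (INF a\<in>F x. f x a) < r" for x
  proof (cases "x \<in> X")
    case True
    have "(INF a\<in>F x. f x a) < r \<longleftrightarrow> (\<exists>a\<in>F x. f x a < r)"
      by (rule cINF_less_iff[OF F(1) bdd]) fact+
    also have "\<dots> \<longleftrightarrow> (\<exists>q\<in>\<rat>. q < r \<and> (\<exists>a\<in>F x. f x a \<le> q))"
      by (meson Rats_dense_in_real le_less_trans less_imp_le)
    also have "\<dots> \<longleftrightarrow> x \<in> (\<Union>q\<in>{q \<in> \<rat>. q < r}. fst ` D q)"
      using True by (auto simp: D_def image_iff)
    finally show ?thesis
      using True by simp
  qed (auto simp: D_def)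
  then have "{x \<in> space (restrict_space borel X). (INF a\<in>F x. f x a) < r} =
      X \<inter> (\<Union>q\<in>{q \<in> \<rat>. q < r}. fst ` D q)"
    by (auto simp: space_restrict_space)
  also have "\<dots> \<in> sets (restrict_space borel X)"
    unfolding sets_restrict_space
    by (intro imageI sets.countable_UN' countable_subset[OF _ countable_rat]) (auto intro: Borel)
  finally show "{x \<in> space (restrict_space borel X). (INF a\<in>F x. f x a) < r}
      \<in> sets (restrict_space borel X)" .
qed

lemma cINF_le_add_const:
  fixes f g :: "'a \<Rightarrow> real"
  assumes "S \<noteq> {}" "bdd_below (f ` S)" "\<And>a. a \<in> S \<Longrightarrow> f a \<le> g a + e"
  shows "(INF a\<in>S. f a) \<le> (INF a\<in>S. g a) + e"
proof -
  have "(INF a\<in>S. f a) - e \<le> g a" if "a \<in> S" for a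
    using cINF_lower[OF assms(2) that] assms(3)[OF that] by simp
  then have "(INF a\<in>S. f a) - e \<le> (INF a\<in>S. g a)"
    by (rule cINF_greatest[OF assms(1)])
  then show ?thesis
    by simp
qed

section \<open>Contractions of the weighted span seminorm\<close>

lemma wspace_iff:
  assumes "\<And>x. x \<in> X \<Longrightarrow> 0 < w x"
  shows "u \<in> wspace X w \<longleftrightarrow>
    u \<in> borel_measurable (restrict_space borel X) \<and> (\<exists>s. \<forall>x\<in>X. \<bar>u x\<bar> \<le> s * w x)"
proof -
  have "wnorm X w u < \<infinity> \<longleftrightarrow> (\<exists>s. \<forall>x\<in>X. \<bar>u x\<bar> \<le> s * w x)"
  proof
    assume "wnorm X w u < \<infinity>"
    then obtain s :: real where "wnorm X w u \<le> ereal s"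
      by (cases "wnorm X w u") auto
    then have "\<bar>u x\<bar> / w x \<le> s" if "x \<in> X" for x
      using that by (simp add: wnorm_def SUP_le_iff)
    then have "\<forall>x\<in>X. \<bar>u x\<bar> \<le> s * w x"
      using assms by (simp add: pos_divide_le_eq)
    then show "\<exists>s. \<forall>x\<in>X. \<bar>u x\<bar> \<le> s * w x"
      by blast
  next
    assume "\<exists>s. \<forall>x\<in>X. \<bar>u x\<bar> \<le> s * w x"
    then obtain s where "\<forall>x\<in>X. \<bar>u x\<bar> \<le> s * w x"
      by blast
    then have "wnorm X w u \<le> ereal s"
      using assms by (auto simp: wnorm_def SUP_le_iff pos_divide_le_eq)
    also have "\<dots> < \<infinity>"
      by simp
    finally show "wnorm X w u < \<infinity>" .
  qed
  then show ?thesis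
    by (simp add: wspace_def)
qed

text \<open>\<open>T_span\<close> asks for a bound on the weighted norm of \<open>u - v\<close>, the
  form in which the risk estimates arrive; \<open>span_step\<close> relaxes this to a bound on the
  weighted span. \<open>L\<close> may exceed 1: contraction comes from \<kappa> alone.\<close>

locale span_contraction =
  fixes X :: "'x :: topological_space set"
    and w :: "'x \<Rightarrow> real"
    and T :: "('x \<Rightarrow> real) \<Rightarrow> 'x \<Rightarrow> real"
    and \<kappa> L :: real
  assumes nonempty: "X \<noteq> {}"
    and w_ge_1: "x \<in> X \<Longrightarrow> 1 \<le> w x"
    and T_wspace: "u \<in> wspace X w \<Longrightarrow> T u \<in> wspace X w"
    and T_add_const: "u \<in> wspace X w \<Longrightarrow> x \<in> X \<Longrightarrow> T (\<lambda>y. u y + b) x = T u x + b"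
    and T_Lipschitz: "u \<in> wspace X w \<Longrightarrow> v \<in> wspace X w \<Longrightarrow>
      (\<And>y. y \<in> X \<Longrightarrow> \<bar>u y - v y\<bar> \<le> s * w y) \<Longrightarrow> x \<in> X \<Longrightarrow> \<bar>T u x - T v x\<bar> \<le> L * s * w x"
    and T_span: "u \<in> wspace X w \<Longrightarrow> v \<in> wspace X w \<Longrightarrow>
      (\<And>z. z \<in> X \<Longrightarrow> \<bar>u z - v z\<bar> \<le> s * w z) \<Longrightarrow> x \<in> X \<Longrightarrow> y \<in> X \<Longrightarrow>
      (T u x - T v x) - (T u y - T v y) \<le> \<kappa> * s * (w x + w y)"
    and \<kappa>: "0 \<le> \<kappa>" "\<kappa> < 1"
begin

lemma in_wspace_iff:
  "u \<in> wspace X w \<longleftrightarrow>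
    u \<in> borel_measurable (restrict_space borel X) \<and> (\<exists>s. \<forall>x\<in>X. \<bar>u x\<bar> \<le> s * w x)"
  by (rule wspace_iff) (use w_ge_1 in force)

lemma const_wspace: "(\<lambda>_. b) \<in> wspace X w"
proof -
  have "\<bar>b\<bar> \<le> \<bar>b\<bar> * w x" if "x \<in> X" for x
    using mult_left_mono[OF w_ge_1[OF that], of "\<bar>b\<bar>"] by simp
  then show ?thesis
    by (auto simp: in_wspace_iff)
qed

lemma add_wspace:
  assumes "u \<in> wspace X w" "v \<in> wspace X w"
  shows "(\<lambda>x. u x + v x) \<in> wspace X w"
proof -
  obtain s t where "\<forall>x\<in>X. \<bar>u x\<bar> \<le> s * w x" "\<forall>x\<in>X. \<bar>v x\<bar> \<le> t * w x"
    using assms by (auto simp: in_wspace_iff)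
  then have "\<forall>x\<in>X. \<bar>u x + v x\<bar> \<le> (s + t) * w x"
    by (fastforce simp: distrib_right)
  then show ?thesis
    using assms by (auto simp: in_wspace_iff)
qed

lemma diff_wspace:
  assumes "u \<in> wspace X w" "v \<in> wspace X w"
  shows "(\<lambda>x. u x - v x) \<in> wspace X w"
proof -
  have "(\<lambda>x. - v x) \<in> wspace X w"
    using assms(2) by (auto simp: in_wspace_iff)
  from add_wspace[OF assms(1) this] show ?thesis
    by simp
qed

text \<open>The span bound says that \<open>u - v - s * w\<close> never exceeds
  \<open>u - v + s * w\<close>, even at different points, so a constant \<open>b\<close> fits
  between them. Then \<open>u\<close> and \<open>v + b\<close> differ by at most
  \<open>s * w\<close>, and \<open>b\<close> cancels in the difference of the values of
  \<open>T\<close> at two points.\<close>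

lemma span_step:
  assumes u: "u \<in> wspace X w" and v: "v \<in> wspace X w"
    and span: "\<And>x y. x \<in> X \<Longrightarrow> y \<in> X \<Longrightarrow> (u x - v x) - (u y - v y) \<le> s * (w x + w y)"
    and xy: "x \<in> X" "y \<in> X"
  shows "(T u x - T v x) - (T u y - T v y) \<le> \<kappa> * s * (w x + w y)"
proof -
  define b where "b = (SUP z\<in>X. u z - v z - s * w z)"
  have le: "u z - v z - s * w z \<le> u z' - v z' + s * w z'" if "z \<in> X" "z' \<in> X" for z z'
    using span[OF that] by (simp add: algebra_simps)
  have bdd: "bdd_above ((\<lambda>z. u z - v z - s * w z) ` X)"
    using le[OF _ xy(1)] by (rule bdd_aboveI2)
  have "\<bar>u z - (v z + b)\<bar> \<le> s * w z" if z: "z \<in> X" for z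
  proof -
    have "u z - v z - s * w z \<le> b"
      unfolding b_def by (rule cSUP_upper[OF z bdd])
    moreover have "b \<le> u z - v z + s * w z"
      unfolding b_def using nonempty le[OF _ z] by (rule cSUP_least)
    ultimately show ?thesis
      by linarith
  qed
  from T_span[OF u add_wspace[OF v const_wspace] this xy] show ?thesis
    using T_add_const[OF v] xy by simp
qed

text \<open>Normalizing the iterates of \<open>T\<close> to vanish at \<open>x0\<close> turns their
  increments into differences of \<open>h (Suc n) - h n\<close> at two points, which decay like
  powers of \<kappa>. The limit is uniform relative to \<open>w\<close>, so Lipschitz continuity
  lets \<open>T\<close> pass to it.\<close>

lemma fixed_point_exists: "\<exists>\<rho>. \<exists>h\<in>wspace X w. \<forall>x\<in>X. \<rho> + h x = T h x"
proof -
  obtain x0 where x0: "x0 \<in> X"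
    using nonempty by blast
  define h where "h n = (T ^^ n) (\<lambda>_. 0)" for n
  define g where "g n = (\<lambda>x. h n x + - h n x0)" for n
  have h_Suc: "h (Suc n) = T (h n)" for n
    by (simp add: h_def)
  have h: "h n \<in> wspace X w" for n
    by (induction n) (simp_all add: h_Suc T_wspace, simp add: h_def const_wspace)
  have g: "g n \<in> wspace X w" for n
    unfolding g_def using h const_wspace by (rule add_wspace)
  have T_g: "T (g n) x = h (Suc n) x - h n x0" if "x \<in> X" for n x
    using T_add_const[OF h that, of n "- h n x0"] by (simp add: g_def h_Suc)
  obtain s where s: "\<And>x. x \<in> X \<Longrightarrow> \<bar>h 1 x - h 0 x\<bar> \<le> s * w x"
    using diff_wspace[OF h[of 1] h[of 0]] by (auto simp: in_wspace_iff)
  have span: "(h (Suc n) x - h n x) - (h (Suc n) y - h n y) \<le> \<kappa> ^ n * s * (w x + w y)"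
    if "x \<in> X" "y \<in> X" for n x y
    using that
  proof (induction n arbitrary: x y)
    case 0
    then show ?case
      using s[of x] s[of y] by (simp add: distrib_left)
  next
    case (Suc n)
    from span_step[OF h[of "Suc n"] h[of n] Suc.IH Suc.prems] show ?case
      by (simp add: h_Suc mult.assoc)
  qed
  have s_nonneg: "0 \<le> s"
    using order_trans[OF abs_ge_zero s[OF x0]] w_ge_1[OF x0] by (simp add: zero_le_mult_iff)
  \<comment> \<open>Chosen so that, using \<open>w x \<ge> 1\<close>, the \<open>n\<close>-th
    increment is at most \<open>(\<kappa> ^ n - \<kappa> ^ Suc n) * (M * w x)\<close>, a bound that
    telescopes.\<close>
  define M where "M = s * (1 + w x0) / (1 - \<kappa>)"
  have M: "M * (1 - \<kappa>) = s * (1 + w x0)"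
    using \<kappa>(2) by (simp add: M_def)
  have M_nonneg: "0 \<le> M"
    using s_nonneg w_ge_1[OF x0] \<kappa>(2) by (simp add: M_def)
  have incr: "\<bar>g (Suc n) x - g n x\<bar> \<le> (\<kappa> ^ n - \<kappa> ^ Suc n) * (M * w x)" if x: "x \<in> X" for n x
  proof -
    have "\<bar>g (Suc n) x - g n x\<bar> \<le> \<kappa> ^ n * s * (w x + w x0)"
      using span[OF x x0, of n] span[OF x0 x, of n] by (simp add: g_def abs_le_iff add.commute)
    also have "\<dots> \<le> \<kappa> ^ n * s * ((1 + w x0) * w x)"
      using mult_left_mono[OF w_ge_1[OF x], of "w x0"] w_ge_1[OF x0] s_nonneg \<kappa>(1)
      by (intro mult_left_mono) (auto simp: algebra_simps)
    also have "\<dots> = \<kappa> ^ n * (M * (1 - \<kappa>)) * w x"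
      by (simp add: M)
    finally show ?thesis
      by (simp add: algebra_simps)
  qed
  have dist: "\<bar>g m x - g n x\<bar> \<le> (\<kappa> ^ n - \<kappa> ^ m) * (M * w x)" if "x \<in> X" "n \<le> m" for m n x
    using that(2)
  proof (induction rule: dec_induct)
    case (step m)
    then show ?case
      using incr[OF that(1), of m]
      by (simp add: left_diff_distrib)
  qed simp
  have w_M: "0 \<le> M * w x" if "x \<in> X" for x
    using M_nonneg w_ge_1[OF that] by simp
  have dist': "\<bar>g m x - g n x\<bar> \<le> \<kappa> ^ n * (M * w x)" if "x \<in> X" "n \<le> m" for m n x
    using dist[OF that] mult_nonneg_nonneg[OF zero_le_power[OF \<kappa>(1), of m] w_M[OF that(1)]]
    by (simp add: left_diff_distrib)
  have lim_\<kappa>: "(\<lambda>n. \<kappa> ^ n * C) \<longlonglongrightarrow> 0" for C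
    using tendsto_mult_left_zero[OF LIMSEQ_realpow_zero[OF \<kappa>]] .
  have conv: "convergent (\<lambda>n. g n x)" if x: "x \<in> X" for x
  proof -
    have "Cauchy (\<lambda>n. g n x)"
    proof (rule metric_CauchyI)
      fix e :: real assume "0 < e"
      then have "0 < e / 2"
        by simp
      from order_tendstoD(2)[OF lim_\<kappa>[of "M * w x"] this]
      obtain N where N: "\<kappa> ^ N * (M * w x) < e / 2"
        by (auto simp: eventually_sequentially)
      have "dist (g n x) (g N x) < e / 2" if "N \<le> n" for n
        using dist'[OF x that] N by (simp add: dist_real_def)
      then show "\<exists>N. \<forall>m\<ge>N. \<forall>n\<ge>N. dist (g m x) (g n x) < e"
        by (meson dist_triangle_half_l dist_commute_lessI)
    qed
    then show ?thesis
      by (simp add: Cauchy_convergent_iff)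
  qed
  define G where "G x = lim (\<lambda>n. g n x)" for x
  have lim_G: "(\<lambda>n. g n x) \<longlonglongrightarrow> G x" if "x \<in> X" for x
    using conv[OF that] by (simp add: G_def convergent_LIMSEQ_iff)
  have G_dist: "\<bar>G x - g n x\<bar> \<le> (M * \<kappa> ^ n) * w x" if x: "x \<in> X" for n x
  proof (rule LIMSEQ_le_const2)
    show "(\<lambda>m. \<bar>g m x - g n x\<bar>) \<longlonglongrightarrow> \<bar>G x - g n x\<bar>"
      by (intro tendsto_intros lim_G x)
    show "\<exists>N. \<forall>m\<ge>N. \<bar>g m x - g n x\<bar> \<le> (M * \<kappa> ^ n) * w x"
      using dist'[OF x] by (auto simp: mult_ac)
  qed
  have G_meas: "G \<in> borel_measurable (restrict_space borel X)"
    by (rule borel_measurable_LIMSEQ_metric[of g])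
       (use g lim_G in \<open>auto simp: in_wspace_iff space_restrict_space\<close>)
  have G: "G \<in> wspace X w"
  proof -
    have "\<bar>G x\<bar> \<le> M * w x" if "x \<in> X" for x
      using G_dist[OF that, of 0] by (simp add: g_def h_def)
    then show ?thesis
      using G_meas by (auto simp: in_wspace_iff)
  qed
  have lim_T: "(\<lambda>n. T (g n) x) \<longlonglongrightarrow> T G x" if x: "x \<in> X" for x
  proof (rule LIM_zero_cancel, rule Lim_null_comparison)
    show "\<forall>\<^sub>F n in sequentially. norm (T (g n) x - T G x) \<le> \<kappa> ^ n * (L * M * w x)"
      using T_Lipschitz[OF G g G_dist x]
      by (intro always_eventually) (simp add: abs_minus_commute mult_ac)
    show "(\<lambda>n. \<kappa> ^ n * (L * M * w x)) \<longlonglongrightarrow> 0"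
      by (rule lim_\<kappa>)
  qed
  have "T G x0 + G x = T G x" if x: "x \<in> X" for x
  proof -
    \<comment> \<open>Subtracting the value at \<open>x0\<close> cancels the constant in
      \<open>T_g\<close>. The limit of this recursion is the fixed point equation with \<rho> equal
      to \<open>T G x0\<close>.\<close>
    have "g (Suc n) x = T (g n) x - T (g n) x0" for n
      using T_g[OF x, of n] T_g[OF x0, of n] by (simp add: g_def)
    then have "(\<lambda>n. g (Suc n) x) \<longlonglongrightarrow> T G x - T G x0"
      by (simp add: tendsto_diff lim_T x x0)
    moreover have "(\<lambda>n. g (Suc n) x) \<longlonglongrightarrow> G x"
      using lim_G[OF x] by (rule LIMSEQ_Suc)
    ultimately have "T G x - T G x0 = G x"
      by (rule LIMSEQ_unique)
    then show ?thesis
      by simp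
  qed
  then show ?thesis
    using G by blast
qed

text \<open>The difference of two solutions has the same span as its image under \<open>T\<close>,
  so contraction makes the span 0 and the difference constant on \<open>X\<close>. As
  \<open>T\<close> commutes with constants, the two values of \<rho> agree.\<close>

lemma fixed_point_unique:
  assumes h: "h \<in> wspace X w" "\<And>x. x \<in> X \<Longrightarrow> \<rho> + h x = T h x"
    and h': "h' \<in> wspace X w" "\<And>x. x \<in> X \<Longrightarrow> \<rho>' + h' x = T h' x"
  shows "\<rho> = \<rho>'"
proof -
  obtain x0 where x0: "x0 \<in> X"
    using nonempty by blast
  obtain s where s: "\<And>x. x \<in> X \<Longrightarrow> \<bar>h x - h' x\<bar> \<le> s * w x"
    using diff_wspace[OF h(1) h'(1)] by (auto simp: in_wspace_iff)
  have span: "(h x - h' x) - (h y - h' y) \<le> \<kappa> ^ n * s * (w x + w y)"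
    if "x \<in> X" "y \<in> X" for n x y
    using that
  proof (induction n arbitrary: x y)
    case 0
    then show ?case
      using s[of x] s[of y] by (simp add: distrib_left)
  next
    case (Suc n)
    have "h z - h' z = T h z - T h' z - (\<rho> - \<rho>')" if "z \<in> X" for z
      using h(2)[OF that] h'(2)[OF that] by simp
    with span_step[OF h(1) h'(1) Suc.IH Suc.prems] Suc.prems show ?case
      by (simp add: mult.assoc)
  qed
  have "(h x - h' x) - (h y - h' y) \<le> 0" if "x \<in> X" "y \<in> X" for x y
  proof (rule LIMSEQ_le_const)
    show "(\<lambda>n. \<kappa> ^ n * (s * (w x + w y))) \<longlonglongrightarrow> 0"
      using tendsto_mult_left_zero[OF LIMSEQ_realpow_zero[OF \<kappa>]] .
    show "\<exists>N. \<forall>n\<ge>N. (h x - h' x) - (h y - h' y) \<le> \<kappa> ^ n * (s * (w x + w y))"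
      using span[OF that] by (auto simp: mult.assoc)
  qed
  from this[OF _ x0] this[OF x0] have "h x = h' x + (h x0 - h' x0)" if "x \<in> X" for x
    using that by fastforce
  \<comment> \<open>The functions agree on \<open>X\<close> but possibly not outside, so they cannot
    be substituted for each other under \<open>T\<close>; the Lipschitz bound with
    \<open>s = 0\<close> takes the place of equality.\<close>
  then have "\<bar>h x - (h' x + (h x0 - h' x0))\<bar> \<le> 0 * w x" if "x \<in> X" for x
    using that by fastforce
  from T_Lipschitz[OF h(1) add_wspace[OF h'(1) const_wspace] this x0]
  have "T h x0 = T h' x0 + (h x0 - h' x0)"
    using T_add_const[OF h'(1) x0] by simp
  then show ?thesis
    using h(2)[OF x0] h'(2)[OF x0] by simp
qed

end

section \<open>The average risk optimality equation\<close>

theorem theorem5p9: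
  fixes X :: "'x :: polish_space set"
    and A :: "'a :: polish_space set"
    and F :: "'x \<Rightarrow> 'a set"
    and Q :: "'x \<times> 'a \<Rightarrow> 'x measure"
    and c :: "'x \<times> 'a \<Rightarrow> real"
    and W w :: "'x \<Rightarrow> real"
    and K \<gamma> \<alpha> \<alpha>\<^sub>0 \<beta> R cbar :: real
    and B :: "'x set"
    and \<R> :: "'x \<Rightarrow> 'a \<Rightarrow> ('x \<Rightarrow> real) \<Rightarrow> real"
    and \<nu> :: "('x \<Rightarrow> real) \<Rightarrow> real"
  assumes mcp: "markov_control_process X A F Q c"
    and W_meas: "W \<in> borel_measurable (restrict_space borel X)"
    and W_nonneg: "\<forall>x\<in>X. 0 \<le> W x"
    and K: "0 < K"
    and \<gamma>: "\<gamma> \<in> {0<..<1}"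
    and \<alpha>: "\<alpha> \<in> {0<..<1}"
    and \<alpha>\<^sub>0: "\<alpha>\<^sub>0 \<in> {0<..<\<alpha>}"
    and \<beta>: "\<beta> = \<alpha>\<^sub>0 / K"
    and w: "w = (\<lambda>x. 1 + \<beta> * W x)"
    and risk_map: "risk_map X F w \<R>"
    and risk_measure: "risk_measure X w \<nu>"
    and drift: "\<forall>(x, a)\<in>Sigma X F. risk_sharp_bar X w (\<R> x a) W \<le> ereal (\<gamma> * W x + K)"
    and R: "R > 2 * K / (1 - \<gamma>)"
    and B: "B = {x \<in> X. W x \<le> R}"
    and minorization: "\<forall>u\<in>wspace X w. \<forall>v\<in>wspace X w. (\<forall>x\<in>X. u x \<le> v x) \<longrightarrow>
          (INF (x, a)\<in>{(x, a). x \<in> B \<and> (x, a) \<in> Sigma X F}.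
             ereal (\<R> x a v - \<alpha> * \<nu> v - \<R> x a u + \<alpha> * \<nu> u)) \<ge> 0"
    and cbar: "0 \<le> cbar"
    and cost_bound: "\<forall>x\<in>X. (SUP a\<in>F x. ereal \<bar>c (x, a)\<bar>) \<le> ereal (cbar * w x)"
    and cost_lsc: "\<forall>x\<in>X. lsc_on (F x) (\<lambda>a. c (x, a))"
    and feasible_compact: "\<forall>x\<in>X. compact (F x)"
    and risk_continuous: "\<forall>x\<in>X. \<forall>u\<in>wspace X w. continuous_on (F x) (\<lambda>a. \<R> x a u)"
  shows "\<exists>!\<rho>. \<exists>h\<in>wspace X w. \<forall>x\<in>X.
           ereal (\<rho> + h x) = (INF a\<in>F x. ereal (c (x, a) + \<R> x a h))"
proof -
  interpret markov_control_process X A F Q c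
    by (rule mcp)

  \<comment> \<open>Functions in the weighted space\<close>
  have \<beta>_pos: "0 < \<beta>" and \<alpha>\<^sub>0_eq: "\<beta> * K = \<alpha>\<^sub>0" and \<alpha>\<^sub>0_pos: "0 < \<alpha>\<^sub>0"
    using K \<alpha>\<^sub>0 by (auto simp: \<beta>)
  have R_pos: "0 < R"
    using R K \<gamma> by (smt (verit) divide_pos_pos greaterThanLessThan_iff)
  have w_ge_1: "1 \<le> w x" if "x \<in> X" for x
    using W_nonneg that \<beta>_pos by (simp add: w)
  have in_wspace: "u \<in> wspace X w \<longleftrightarrow>
      u \<in> borel_measurable (restrict_space borel X) \<and> (\<exists>s. \<forall>x\<in>X. \<bar>u x\<bar> \<le> s * w x)" for u
    by (rule wspace_iff) (use w_ge_1 in force)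
  have lin_wspace: "(\<lambda>y. l * W y + b + u y) \<in> wspace X w" if u: "u \<in> wspace X w" for l b u
  proof -
    obtain s where s: "\<forall>x\<in>X. \<bar>u x\<bar> \<le> s * w x"
      using u by (auto simp: in_wspace)
    have "\<bar>l * W x + b + u x\<bar> \<le> (\<bar>l\<bar> / \<beta> + \<bar>b\<bar> + s) * w x" if x: "x \<in> X" for x
    proof -
      have "\<bar>l * W x\<bar> \<le> \<bar>l\<bar> / \<beta> * w x"
        using W_nonneg x \<beta>_pos by (simp add: abs_mult w field_simps)
      moreover have "\<bar>b\<bar> \<le> \<bar>b\<bar> * w x"
        using mult_left_mono[OF w_ge_1[OF x], of "\<bar>b\<bar>"] by simp
      moreover have "\<bar>u x\<bar> \<le> s * w x"
        using s x by blast
      ultimately show ?thesis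
        unfolding distrib_right by linarith
    qed
    moreover have "(\<lambda>y. l * W y + b + u y) \<in> borel_measurable (restrict_space borel X)"
      using W_meas u by (auto simp: in_wspace)
    ultimately show ?thesis
      unfolding in_wspace by blast
  qed
  have sw_wspace: "(\<lambda>y. u y + s * w y) \<in> wspace X w" if "u \<in> wspace X w" for u s
    using lin_wspace[OF that, of "s * \<beta>" s] by (simp add: w algebra_simps)
  have const_wspace: "(\<lambda>y. u y + b) \<in> wspace X w" if "u \<in> wspace X w" for u b
    using lin_wspace[OF that, of 0 b] by (simp add: algebra_simps)
  have zero_wspace: "(\<lambda>_. 0) \<in> wspace X w"
    unfolding in_wspace by (auto intro: exI[of _ 0])

  \<comment> \<open>Drift and minorization estimates for the risk maps\<close>
  have risk_R: "risk_measure X w (\<R> x a)" if "x \<in> X" "a \<in> F x" for x a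
    using risk_map that by (auto simp: risk_map_def)
  have R_mono: "\<R> x a u \<le> \<R> x a v"
    if "x \<in> X" "a \<in> F x" "u \<in> wspace X w" "v \<in> wspace X w" "\<And>y. y \<in> X \<Longrightarrow> u y \<le> v y" for x a u v
    using risk_R[OF that(1,2)] that(3-) by (simp add: risk_measure_def)
  have R_const: "\<R> x a (\<lambda>y. u y + b) = \<R> x a u + b"
    if "x \<in> X" "a \<in> F x" "u \<in> wspace X w" for x a u b
    using risk_R[OF that(1,2)] that(3) by (simp add: risk_measure_def)
  have R_zero: "\<R> x a (\<lambda>_. 0) = 0" if "x \<in> X" "a \<in> F x" for x a
    using risk_R[OF that] by (simp add: risk_measure_def)
  have R_meas: "(\<lambda>(x, a). \<R> x a u) \<in> borel_measurable (restrict_space borel (Sigma X F))"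
    if "u \<in> wspace X w" for u
    using risk_map that by (simp add: risk_map_def)
  have \<nu>_mono: "\<nu> u \<le> \<nu> v"
    if "u \<in> wspace X w" "v \<in> wspace X w" "\<And>y. y \<in> X \<Longrightarrow> u y \<le> v y" for u v
    using risk_measure that by (simp add: risk_measure_def)
  have \<nu>_const: "\<nu> (\<lambda>y. u y + b) = \<nu> u + b" if "u \<in> wspace X w" for u b
    using risk_measure that by (simp add: risk_measure_def)

  have R_drift: "\<R> x a (\<lambda>y. l * W y + u y) - \<R> x a u \<le> l * (\<gamma> * W x + K)"
    if x: "x \<in> X" "a \<in> F x" and u: "u \<in> wspace X w" and l: "0 < l" for x a u l
  proof -
    have "risk_sharp X w (\<R> x a) (\<lambda>y. l * W y) / ereal l \<le> risk_sharp_bar X w (\<R> x a) W"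
      unfolding risk_sharp_bar_def using l by (intro SUP_upper) simp
    also have "\<dots> \<le> ereal (\<gamma> * W x + K)"
      using drift x by auto
    finally have "risk_sharp X w (\<R> x a) (\<lambda>y. l * W y) \<le> ereal (l * (\<gamma> * W x + K))"
      using l by (simp add: ereal_divide_le_pos)
    moreover have "ereal (\<R> x a (\<lambda>y. l * W y + u y) - \<R> x a u) \<le>
        risk_sharp X w (\<R> x a) (\<lambda>y. l * W y)"
      unfolding risk_sharp_def by (rule SUP_upper[OF u])
    ultimately have "ereal (\<R> x a (\<lambda>y. l * W y + u y) - \<R> x a u) \<le> ereal (l * (\<gamma> * W x + K))"
      by (rule order_trans[rotated])
    then show ?thesis
      by simp
  qed
  have R_add: "\<R> x a (\<lambda>y. u y + s * w y) \<le> \<R> x a u + s * (1 + \<alpha>\<^sub>0 + \<beta> * \<gamma> * W x)"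
    if x: "x \<in> X" "a \<in> F x" and u: "u \<in> wspace X w" and s: "0 \<le> s" for x a u s
  \<comment> \<open>Since \<open>s * w\<close> is \<open>s\<close> plus \<open>s * \<beta>\<close>
    times \<open>W\<close>, translation handles the constant and the drift condition with
    \<open>l = s * \<beta>\<close> the rest; \<open>\<beta> * K\<close> is
    \<open>\<alpha>\<^sub>0\<close>. The case \<open>s = 0\<close> stands apart because
    \<open>l\<close> must be positive.\<close>
  proof (cases "s = 0")
    case False
    have "\<R> x a (\<lambda>y. (s * \<beta>) * W y + (u y + s)) - \<R> x a (\<lambda>y. u y + s) \<le> (s * \<beta>) * (\<gamma> * W x + K)"
      by (rule R_drift[OF x const_wspace[OF u]]) (use s False \<beta>_pos in auto)
    then have "\<R> x a (\<lambda>y. u y + s * w y) \<le> \<R> x a u + s + (s * \<beta>) * (\<gamma> * W x + K)"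
      using R_const[OF x u, of s] by (simp add: w algebra_simps)
    then show ?thesis
      by (simp add: \<alpha>\<^sub>0_eq[symmetric] algebra_simps)
  qed simp
  have R_diff: "\<R> x a u \<le> \<R> x a v + s * (1 + \<alpha>\<^sub>0 + \<beta> * \<gamma> * W x)"
    if x: "x \<in> X" "a \<in> F x" and u: "u \<in> wspace X w" and v: "v \<in> wspace X w"
      and le: "\<And>y. y \<in> X \<Longrightarrow> \<bar>u y - v y\<bar> \<le> s * w y" for x a u v s
  proof -
    have "0 \<le> s"
      using order_trans[OF abs_ge_zero le[OF x(1)]] w_ge_1[OF x(1)] by (simp add: zero_le_mult_iff)
    have "\<R> x a u \<le> \<R> x a (\<lambda>y. v y + s * w y)"
      by (rule R_mono[OF x u sw_wspace[OF v]]) (use le in \<open>force simp: abs_le_iff\<close>)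
    with R_add[OF x v \<open>0 \<le> s\<close>] show ?thesis
      by simp
  qed
  have minor: "\<alpha> * (\<nu> v - \<nu> u) \<le> \<R> x a v - \<R> x a u"
    if x: "x \<in> X" "W x \<le> R" "a \<in> F x" and u: "u \<in> wspace X w" and v: "v \<in> wspace X w"
      and le: "\<And>y. y \<in> X \<Longrightarrow> u y \<le> v y" for x a u v
  proof -
    have "0 \<le> (INF (x, a)\<in>{(x, a). x \<in> B \<and> (x, a) \<in> Sigma X F}.
        ereal (\<R> x a v - \<alpha> * \<nu> v - \<R> x a u + \<alpha> * \<nu> u))"
      by (rule minorization[rule_format, OF u v le])
    also have "\<dots> \<le> ereal (\<R> x a v - \<alpha> * \<nu> v - \<R> x a u + \<alpha> * \<nu> u)"
      by (rule INF_lower2[of "(x, a)"]) (use x in \<open>auto simp: B\<close>)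
    finally show ?thesis
      by (simp add: algebra_simps)
  qed

  have c_bound: "\<bar>c (x, a)\<bar> \<le> cbar * w x" if "x \<in> X" "a \<in> F x" for x a
  proof -
    have "ereal \<bar>c (x, a)\<bar> \<le> (SUP a\<in>F x. ereal \<bar>c (x, a)\<bar>)"
      using that(2) by (rule SUP_upper)
    also have "\<dots> \<le> ereal (cbar * w x)"
      using cost_bound that(1) by blast
    finally show ?thesis
      by simp
  qed
  \<comment> \<open>This cruder bound does not contract; it yields growth bounds and the Lipschitz
    constant \<open>1 + \<alpha>\<^sub>0\<close> in the weighted norm.\<close>
  have \<gamma>_le: "1 + \<alpha>\<^sub>0 + \<beta> * \<gamma> * W x \<le> (1 + \<alpha>\<^sub>0) * w x" if "x \<in> X" for x
  proof -
    have "\<gamma> * (\<beta> * W x) \<le> (1 + \<alpha>\<^sub>0) * (\<beta> * W x)"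
      using W_nonneg that \<beta>_pos \<gamma> \<alpha>\<^sub>0_pos by (intro mult_right_mono) auto
    then show ?thesis
      by (simp add: w algebra_simps)
  qed
  have R_diff_w: "\<R> x a u \<le> \<R> x a v + (1 + \<alpha>\<^sub>0) * s * w x"
    if x: "x \<in> X" "a \<in> F x" and u: "u \<in> wspace X w" and v: "v \<in> wspace X w"
      and le: "\<And>y. y \<in> X \<Longrightarrow> \<bar>u y - v y\<bar> \<le> s * w y" for x a u v s
  proof -
    have "0 \<le> s"
      using order_trans[OF abs_ge_zero le[OF x(1)]] w_ge_1[OF x(1)] by (simp add: zero_le_mult_iff)
    from R_diff[OF x u v le] mult_left_mono[OF \<gamma>_le[OF x(1)] this] show ?thesis
      by (simp add: mult_ac)
  qed

  \<comment> \<open>The operator of the optimality equation\<close>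
  define f where "f u x a = c (x, a) + \<R> x a u" for u x a
  define T where "T u x = (INF a\<in>F x. f u x a)" for u x
  have f_bound: "\<exists>t. \<forall>x\<in>X. \<forall>a\<in>F x. \<bar>f u x a\<bar> \<le> t * w x" if u: "u \<in> wspace X w" for u
  proof -
    obtain s where s: "\<And>y. y \<in> X \<Longrightarrow> \<bar>u y\<bar> \<le> s * w y"
      using u by (auto simp: in_wspace)
    have "\<bar>f u x a\<bar> \<le> (cbar + (1 + \<alpha>\<^sub>0) * s) * w x" if x: "x \<in> X" "a \<in> F x" for x a
    proof -
      have "\<bar>\<R> x a u\<bar> \<le> (1 + \<alpha>\<^sub>0) * s * w x"
        using R_diff_w[OF x u zero_wspace, of s] R_diff_w[OF x zero_wspace u, of s] s
        by (simp add: R_zero[OF x])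
      then show ?thesis
        using c_bound[OF x] by (simp add: f_def distrib_right)
    qed
    then show ?thesis
      by blast
  qed
  have f_bdd: "bdd_below (f u x ` F x)" if u: "u \<in> wspace X w" and x: "x \<in> X" for u x
  proof -
    obtain t where "\<And>a. a \<in> F x \<Longrightarrow> \<bar>f u x a\<bar> \<le> t * w x"
      using f_bound[OF u] x by blast
    then have "- (t * w x) \<le> f u x a" if "a \<in> F x" for a
      using that by (fastforce simp: abs_le_iff)
    then show ?thesis
      by (rule bdd_belowI2)
  qed
  have T_le: "T u x \<le> T v x + e"
    if u: "u \<in> wspace X w" and x: "x \<in> X"
      and le: "\<And>a. a \<in> F x \<Longrightarrow> \<R> x a u \<le> \<R> x a v + e" for u v x e
    unfolding T_def
  proof (rule cINF_le_add_const[OF feasible_nonempty[OF x] f_bdd[OF u x]])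
    show "f u x a \<le> f v x a + e" if "a \<in> F x" for a
      using le[OF that] by (simp add: f_def)
  qed
  have T_meas: "T u \<in> borel_measurable (restrict_space borel X)" if u: "u \<in> wspace X w" for u
    unfolding T_def
  proof (rule borel_measurable_INF_compact[OF feasible_pairs_borel])
    show "(\<lambda>(x, a). f u x a) \<in> borel_measurable (restrict_space borel (Sigma X F))"
      using borel_measurable_add[OF cost_measurable R_meas[OF u]]
      by (simp add: f_def case_prod_unfold)
    show "lsc_on (F x) (f u x)" if "x \<in> X" for x
      unfolding f_def using cost_lsc risk_continuous u that
      by (intro lsc_on_add_continuous) auto
  qed (use feasible_nonempty feasible_compact f_bdd u in auto)
  have T_wspace: "T u \<in> wspace X w" if u: "u \<in> wspace X w" for u
  proof -
    obtain t where t: "\<forall>x\<in>X. \<forall>a\<in>F x. \<bar>f u x a\<bar> \<le> t * w x"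
      using f_bound[OF u] by blast
    have "\<bar>T u x\<bar> \<le> t * w x" if "x \<in> X" for x
      unfolding T_def using feasible_nonempty[OF that] t that by (intro cInf_abs_ge) auto
    then show ?thesis
      unfolding in_wspace using T_meas[OF u] by blast
  qed

  \<comment> \<open>The first entry serves pairs of states with \<open>W x + W y \<ge> R\<close>,
    the other two serve pairs with both states in \<open>B\<close>. They are below 1 by the choice
    of \<open>R\<close>, by \<open>\<alpha>\<^sub>0 < \<alpha>\<close> and by \<gamma> < 1.\<close>
  define \<kappa> where "\<kappa> = max ((2 + \<beta> * (\<gamma> * R + 2 * K)) / (2 + \<beta> * R)) (max (1 - (\<alpha> - \<alpha>\<^sub>0)) \<gamma>)"
  have \<kappa>_less: "\<kappa> < 1"
  proof -
    have "2 * K < (1 - \<gamma>) * R"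
      using R \<gamma> by (simp add: pos_divide_less_eq mult.commute)
    then have "\<gamma> * R + 2 * K < R"
      by (simp add: left_diff_distrib)
    then have "\<beta> * (\<gamma> * R + 2 * K) < \<beta> * R"
      using \<beta>_pos by (rule mult_strict_left_mono)
    moreover have "0 < 2 + \<beta> * R"
      using \<beta>_pos R_pos by (simp add: add_pos_pos)
    ultimately show ?thesis
      using \<alpha>\<^sub>0 \<gamma> by (simp add: \<kappa>_def)
  qed
  have far: "2 + 2 * \<alpha>\<^sub>0 + \<beta> * \<gamma> * t \<le> \<kappa> * (2 + \<beta> * t)" if t: "R \<le> t" for t
  proof -
    \<comment> \<open>For \<open>t \<ge> R\<close> the constant \<open>2 * K\<close> is at most
      \<open>2 * K * t / R\<close>, so it can be absorbed into the slope. As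
      \<open>p \<le> 1\<close>, the quotient of \<open>2 + \<beta> * p * t\<close> by
      \<open>2 + \<beta> * t\<close> does not increase with \<open>t\<close>, and its value at
      \<open>R\<close> is the first entry of \<kappa>.\<close>
    define p where "p = \<gamma> + 2 * K / R"
    have pR: "p * R = \<gamma> * R + 2 * K"
      using R_pos by (simp add: p_def distrib_right)
    have "2 * K < (1 - \<gamma>) * R"
      using R \<gamma> by (simp add: pos_divide_less_eq mult.commute)
    then have p: "p \<le> 1"
      using R_pos pos_divide_less_eq[of R "2 * K" "1 - \<gamma>"] by (simp add: p_def)
    have "K * R \<le> K * t"
      using t K by simp
    then have "K \<le> K * t / R"
      using R_pos by (simp add: pos_le_divide_eq)
    then have "2 * K + \<gamma> * t \<le> p * t"
      by (simp add: p_def distrib_right)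
    then have "\<beta> * (2 * K + \<gamma> * t) \<le> \<beta> * (p * t)"
      using \<beta>_pos by (intro mult_left_mono) auto
    then have "2 + 2 * \<alpha>\<^sub>0 + \<beta> * \<gamma> * t \<le> 2 + \<beta> * (p * t)"
      by (simp add: \<alpha>\<^sub>0_eq[symmetric] algebra_simps)
    also have "\<dots> \<le> (2 + \<beta> * (p * R)) / (2 + \<beta> * R) * (2 + \<beta> * t)"
    proof -
      have "0 \<le> \<beta> * ((1 - p) * (t - R))"
        using \<beta>_pos p t by (intro mult_nonneg_nonneg) auto
      then have "(2 + \<beta> * (p * t)) * (2 + \<beta> * R) \<le> (2 + \<beta> * (p * R)) * (2 + \<beta> * t)"
        by (simp add: algebra_simps)
      moreover have "0 < 2 + \<beta> * R"
        using \<beta>_pos R_pos by (simp add: add_pos_pos)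
      ultimately show ?thesis
        by (simp add: pos_le_divide_eq)
    qed
    also have "\<dots> \<le> \<kappa> * (2 + \<beta> * t)"
      using \<beta>_pos R_pos t by (intro mult_right_mono) (auto simp: \<kappa>_def pR)
    finally show ?thesis .
  qed
  have near: "2 + 2 * \<alpha>\<^sub>0 + \<beta> * \<gamma> * t - 2 * \<alpha> \<le> \<kappa> * (2 + \<beta> * t)" if t: "0 \<le> t" for t
  proof -
    have "1 - (\<alpha> - \<alpha>\<^sub>0) \<le> \<kappa>"
      by (simp add: \<kappa>_def)
    moreover have "\<gamma> * (\<beta> * t) \<le> \<kappa> * (\<beta> * t)"
      using \<beta>_pos t by (intro mult_right_mono) (auto simp: \<kappa>_def)
    ultimately show ?thesis
      by (simp add: algebra_simps)
  qed

  \<comment> \<open>Contraction of the weighted span\<close>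
  interpret span_contraction X w T \<kappa> "1 + \<alpha>\<^sub>0"
  proof
    show "X \<noteq> {}"
    proof
      assume "X = {}"
      \<comment> \<open>On an empty state space monotonicity would hold between any two functions,
        contradicting translation of the risk measure \<nu>.\<close>
      then have "\<nu> (\<lambda>y. 0 + 1) \<le> \<nu> (\<lambda>_. 0)"
        by (intro \<nu>_mono const_wspace zero_wspace) auto
      then show False
        using \<nu>_const[OF zero_wspace, of 1] by simp
    qed
    show "T (\<lambda>y. u y + b) x = T u x + b" if u: "u \<in> wspace X w" and x: "x \<in> X" for u b x
    proof (rule antisym)
      show "T (\<lambda>y. u y + b) x \<le> T u x + b"
        by (rule T_le[OF const_wspace[OF u] x]) (simp add: R_const x u)
      have "T u x \<le> T (\<lambda>y. u y + b) x + (- b)"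
        by (rule T_le[OF u x]) (simp add: R_const x u)
      then show "T u x + b \<le> T (\<lambda>y. u y + b) x"
        by simp
    qed
    show "\<bar>T u x - T v x\<bar> \<le> (1 + \<alpha>\<^sub>0) * s * w x"
      if u: "u \<in> wspace X w" and v: "v \<in> wspace X w"
        and le: "\<And>y. y \<in> X \<Longrightarrow> \<bar>u y - v y\<bar> \<le> s * w y" and x: "x \<in> X" for u v s x
    proof -
      have le': "\<And>y. y \<in> X \<Longrightarrow> \<bar>v y - u y\<bar> \<le> s * w y"
        using le by (simp add: abs_minus_commute)
      show ?thesis
        using T_le[OF u x R_diff_w[OF x _ u v le]] T_le[OF v x R_diff_w[OF x _ v u le']]
        by (simp add: abs_le_iff)
    qed
    show "(T u x - T v x) - (T u y - T v y) \<le> \<kappa> * s * (w x + w y)"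
      if u: "u \<in> wspace X w" and v: "v \<in> wspace X w"
        and le: "\<And>y. y \<in> X \<Longrightarrow> \<bar>u y - v y\<bar> \<le> s * w y" and x: "x \<in> X" and y: "y \<in> X" for u v s x y
    proof -
      define t where "t = W x + W y"
      have le': "\<And>y. y \<in> X \<Longrightarrow> \<bar>v y - u y\<bar> \<le> s * w y"
        using le by (simp add: abs_minus_commute)
      have s: "0 \<le> s"
        using order_trans[OF abs_ge_zero le[OF x]] w_ge_1[OF x] by (simp add: zero_le_mult_iff)
      have w_xy: "w x + w y = 2 + \<beta> * t"
        by (simp add: w t_def algebra_simps)
      consider "R \<le> t" | "t < R"
        by linarith
      then show ?thesis
      proof cases
        case 1
        have "(T u x - T v x) - (T u y - T v y) \<le>
            s * (1 + \<alpha>\<^sub>0 + \<beta> * \<gamma> * W x) + s * (1 + \<alpha>\<^sub>0 + \<beta> * \<gamma> * W y)"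
          using T_le[OF u x R_diff[OF x _ u v le]] T_le[OF v y R_diff[OF y _ v u le']] by simp
        also have "\<dots> = s * (2 + 2 * \<alpha>\<^sub>0 + \<beta> * \<gamma> * t)"
          by (simp add: t_def algebra_simps)
        also have "\<dots> \<le> s * (\<kappa> * (2 + \<beta> * t))"
          by (rule mult_left_mono[OF far[OF 1] s])
        finally show ?thesis
          by (simp add: w_xy mult_ac)
      next
        case 2
        have W: "W x \<le> R" "W y \<le> R"
          using 2 W_nonneg x y by (auto simp: t_def)
        \<comment> \<open>On \<open>X\<close>, \<open>u\<close> lies between \<open>v2\<close> and
          \<open>v1\<close>. Passing from \<open>u\<close> to \<open>v\<close> through
          \<open>v1\<close> at \<open>x\<close>, and from \<open>v\<close> to \<open>u\<close>
          through \<open>v2\<close> at \<open>y\<close>, gains \<alpha> times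
          \<open>\<nu> v1 - \<nu> u\<close> and \<open>\<nu> u - \<nu> v2\<close>. The unknown
          \<open>\<nu> u\<close> cancels in the sum, and \<open>w \<ge> 1\<close> makes
          \<open>\<nu> v1 - \<nu> v2\<close> at least \<open>2 * s\<close>.\<close>
        define v1 where "v1 = (\<lambda>z. v z + s * w z)"
        define v2 where "v2 = (\<lambda>z. v z + (- s) * w z)"
        have v12: "v1 \<in> wspace X w" "v2 \<in> wspace X w"
          unfolding v1_def v2_def by (intro sw_wspace v)+
        have le1: "u z \<le> v1 z" and le2: "v2 z \<le> u z" if "z \<in> X" for z
          using le[OF that] by (auto simp: v1_def v2_def abs_le_iff)
        have Rx: "\<R> x a u \<le> \<R> x a v + (s * (1 + \<alpha>\<^sub>0 + \<beta> * \<gamma> * W x) - \<alpha> * (\<nu> v1 - \<nu> u))"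
          if a: "a \<in> F x" for a
          using minor[OF x W(1) a u v12(1) le1] R_add[OF x a v s, folded v1_def] by simp
        have Ry: "\<R> y a v \<le> \<R> y a u + (s * (1 + \<alpha>\<^sub>0 + \<beta> * \<gamma> * W y) - \<alpha> * (\<nu> u - \<nu> v2))"
          if a: "a \<in> F y" for a
        proof -
          have "(\<lambda>z. v2 z + s * w z) = v"
            by (simp add: v2_def)
          then have "\<R> y a v \<le> \<R> y a v2 + s * (1 + \<alpha>\<^sub>0 + \<beta> * \<gamma> * W y)"
            using R_add[OF y a v12(2) s] by simp
          with minor[OF y W(2) a v12(2) u le2] show ?thesis
            by simp
        qed
        have "\<nu> v2 + 2 * s \<le> \<nu> v1"
        proof -
          have "\<nu> (\<lambda>z. v2 z + 2 * s) \<le> \<nu> v1"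
          proof (rule \<nu>_mono[OF const_wspace[OF v12(2)] v12(1)])
            show "v2 z + 2 * s \<le> v1 z" if "z \<in> X" for z
              using mult_left_mono[OF w_ge_1[OF that] s] by (simp add: v1_def v2_def)
          qed
          then show ?thesis
            by (simp add: \<nu>_const[OF v12(2)])
        qed
        then have "\<alpha> * (2 * s) \<le> \<alpha> * (\<nu> v1 - \<nu> v2)"
          using \<alpha> by (intro mult_left_mono) auto
        moreover have "(T u x - T v x) - (T u y - T v y) \<le>
            s * (1 + \<alpha>\<^sub>0 + \<beta> * \<gamma> * W x) - \<alpha> * (\<nu> v1 - \<nu> u) +
            (s * (1 + \<alpha>\<^sub>0 + \<beta> * \<gamma> * W y) - \<alpha> * (\<nu> u - \<nu> v2))"
          using T_le[OF u x Rx] T_le[OF v y Ry] by simp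
        ultimately have "(T u x - T v x) - (T u y - T v y) \<le> s * (2 + 2 * \<alpha>\<^sub>0 + \<beta> * \<gamma> * t - 2 * \<alpha>)"
          by (simp add: t_def algebra_simps)
        also have "\<dots> \<le> s * (\<kappa> * (2 + \<beta> * t))"
          using W_nonneg x y by (intro mult_left_mono[OF near s]) (auto simp: t_def)
        finally show ?thesis
          by (simp add: w_xy mult_ac)
      qed
    qed
    show "0 \<le> \<kappa>"
      using \<gamma> by (simp add: \<kappa>_def le_max_iff_disj)
  qed (use w_ge_1 T_wspace \<kappa>_less in auto)

  \<comment> \<open>From fixed points to the optimality equation\<close>
  have INF_eq: "(INF a\<in>F x. ereal (c (x, a) + \<R> x a h)) = ereal (T h x)"
    if h: "h \<in> wspace X w" and x: "x \<in> X" for h x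
  proof (rule antisym)
    show "ereal (T h x) \<le> (INF a\<in>F x. ereal (c (x, a) + \<R> x a h))"
      using cINF_lower[OF f_bdd[OF h x]] by (intro INF_greatest) (simp add: T_def f_def)
    show "(INF a\<in>F x. ereal (c (x, a) + \<R> x a h)) \<le> ereal (T h x)"
    proof (rule ereal_le_epsilon2)
      fix e :: real assume "0 < e"
      then obtain a where a: "a \<in> F x" "f h x a < T h x + e"
        using cINF_less_iff[OF feasible_nonempty[OF x] f_bdd[OF h x], of "T h x + e"]
        by (auto simp: T_def)
      have "(INF a\<in>F x. ereal (c (x, a) + \<R> x a h)) \<le> ereal (f h x a)"
        unfolding f_def using a(1) by (rule INF_lower)
      also have "\<dots> \<le> ereal (T h x) + ereal e"
        using a(2) by simp
      finally show "(INF a\<in>F x. ereal (c (x, a) + \<R> x a h)) \<le> ereal (T h x) + ereal e" .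
    qed
  qed
  obtain \<rho> h where h: "h \<in> wspace X w" "\<forall>x\<in>X. \<rho> + h x = T h x"
    using fixed_point_exists by blast
  show ?thesis
  proof (rule ex1I[of _ \<rho>])
    show "\<exists>h\<in>wspace X w. \<forall>x\<in>X. ereal (\<rho> + h x) = (INF a\<in>F x. ereal (c (x, a) + \<R> x a h))"
      using h by (auto simp: INF_eq)
    fix \<rho>'
    assume "\<exists>h\<in>wspace X w. \<forall>x\<in>X. ereal (\<rho>' + h x) = (INF a\<in>F x. ereal (c (x, a) + \<R> x a h))"
    then obtain h' where "h' \<in> wspace X w" "\<forall>x\<in>X. \<rho>' + h' x = T h' x"
      by (auto simp: INF_eq)
    then show "\<rho>' = \<rho>"
      using fixed_point_unique h by blast
  qed
qed

end
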